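(* Let $U_-<U_+$ be real numbers and let $D\in C^0([U_-,U_+])$ with $D_*:=\min D\ge0$ and $D^*:=\max D>0$. Then the profile $U$ for $D$ and $(U_-,U_+)$ and its associated flux $Q(y)=D(U(y))U'(y)$ satisfy $$0\le U_+-U(y)\le\big(U_+-U(z)\big)\,\mathrm{e}^{-(y^2-z^2)/(4D^* )}\quad\text{for }0\le z\le y,$$ $$0\le U(y)-U_-\le\big(U(z)-U_-\big)\,\mathrm{e}^{-(y^2-z^2)/(4D^* )}\quad\text{for }0\ge z\ge y,$$ $$0\le Q(\pm y)\le Q(\pm z)\,\mathrm{e}^{-(y^2-z^2)/(4D^* )}\quad\text{for }0\le z\le y.$$ Moreover, the values $U(0)\in{]U_-,U_+[}$ and $Q(0)>0$ are restricted by the inequalities $$\int_{U_-}^{U(0)}(s-U_-)D(s)\,ds\le2Q(0)^2\le(U(0)-U_-)\int_{U_-}^{U(0)}D(s)\,ds,$$ $$\int_{U(0)}^{U_+}(U_+-s)D(s)\,ds\le2Q(0)^2\le(U_+-U(0))\int_{U(0)}^{U_+}D(s)\,ds.$$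
   Context: Profile: extend $D$ to a bounded nonnegative continuous function on $\mathbb{R}$ (e.g. by constants), and put $A(u)=\int_{U_-}^uD(s)\,ds$, $\overline u_\pm(y)=U_-$ for $y<0$, $\overline u_\pm(y)=U_+$ for $y>0$. The profile $U$ is the unique function $U\in L^2_{\mathrm{loc}}(\mathbb{R})$ for which there is $v\in H^1(\mathbb{R})$ with $U=\overline u_\pm+v'$ and $$\int_{\mathbb{R}}\Big(A(U(y))\,\psi''(y)-U(y)\big(\tfrac y2\psi(y)\big)'\Big)\,dy=0\quad\text{for all }\psi\in C^2_c(\mathbb{R}),$$ i.e. the weak solution of $(D(U)U')'+\frac y2U'=0$ on $\mathbb{R}$, $U(\pm\infty)=U_\pm$. It exists, is unique, is nondecreasing with values in $[U_-,U_+]$, and does not depend on the chosen extension of $D$. In degenerate cases where $U$ is not differentiable, $Q$ is understood as the weak derivative of $A\circ U$, and $U,Q$ as suitable representatives. The inequality with $\pm$ holds for each choice of sign. *)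

theory Defs
  imports "HOL-Analysis.Analysis"
begin

definition L1_loc :: "(real \<Rightarrow> real) \<Rightarrow> bool" where
  "L1_loc f \<longleftrightarrow> (\<forall>K. compact K \<longrightarrow> set_integrable lebesgue K f)"

definition L2 :: "(real \<Rightarrow> real) \<Rightarrow> bool" where
  "L2 f \<longleftrightarrow> f \<in> borel_measurable lebesgue \<and> integrable lebesgue (\<lambda>x. (f x)\<^sup>2)"

definition L2_loc :: "(real \<Rightarrow> real) \<Rightarrow> bool" where
  "L2_loc f \<longleftrightarrow> f \<in> borel_measurable lebesgue \<and>
     (\<forall>K. compact K \<longrightarrow> set_integrable lebesgue K (\<lambda>x. (f x)\<^sup>2))"

definition Ck_c :: "nat \<Rightarrow> (real \<Rightarrow> real) \<Rightarrow> bool" where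
  "Ck_c k f \<longleftrightarrow> (\<forall>j<k. \<forall>x. (deriv ^^ j) f differentiable (at x)) \<and>
     continuous_on UNIV ((deriv ^^ k) f) \<and> compact (closure {x. f x \<noteq> 0})"

definition has_weak_derivative :: "(real \<Rightarrow> real) \<Rightarrow> (real \<Rightarrow> real) \<Rightarrow> bool" where
  "has_weak_derivative f g \<longleftrightarrow> L1_loc f \<and> L1_loc g \<and>
     (\<forall>\<phi>. Ck_c 1 \<phi> \<longrightarrow>
        (LINT x|lebesgue. f x * deriv \<phi> x) = - (LINT x|lebesgue. g x * \<phi> x))"

text \<open>\<open>v\<close> lies in the Sobolev space \<open>H\<^sup>1\<close> on the line, with weak derivative \<open>w\<close>.\<close>

definition H1_derivative :: "(real \<Rightarrow> real) \<Rightarrow> (real \<Rightarrow> real) \<Rightarrow> bool" where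
  "H1_derivative v w \<longleftrightarrow> L2 v \<and> L2 w \<and> has_weak_derivative v w"

definition admissible_extension ::
    "(real \<Rightarrow> real) \<Rightarrow> real \<Rightarrow> real \<Rightarrow> (real \<Rightarrow> real) \<Rightarrow> bool" where
  "admissible_extension D Um Up E \<longleftrightarrow>
     continuous_on UNIV E \<and> bounded (range E) \<and> (\<forall>s. 0 \<le> E s) \<and> (\<forall>s\<in>{Um..Up}. E s = D s)"

text \<open>The interval integral is signed, so this is also meant for \<open>u < Um\<close>.\<close>

definition primitive_from :: "real \<Rightarrow> (real \<Rightarrow> real) \<Rightarrow> real \<Rightarrow> real" where
  "primitive_from Um E u = (LBINT s=Um..u. E s)"

definition step_data :: "real \<Rightarrow> real \<Rightarrow> real \<Rightarrow> real" where
  "step_data Um Up y = (if y < 0 then Um else Up)"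

text \<open>
  Weak solutions of \<open>(D(u) u')' + (y/2) u' = 0\<close> with limits \<open>Um\<close>, \<open>Up\<close> at infinity. This is a
  property of the almost-everywhere class of \<open>u\<close>; every admissible extension of \<open>D\<close> is allowed.
\<close>

definition is_profile :: "(real \<Rightarrow> real) \<Rightarrow> real \<Rightarrow> real \<Rightarrow> (real \<Rightarrow> real) \<Rightarrow> bool" where
  "is_profile D Um Up u \<longleftrightarrow> L2_loc u \<and>
     (\<exists>v w. H1_derivative v w \<and> (AE y in lebesgue. u y = step_data Um Up y + w y)) \<and>
     (\<exists>E. admissible_extension D Um Up E \<and>
        (\<forall>\<psi>. Ck_c 2 \<psi> \<longrightarrow>
           (LINT y|lebesgue. primitive_from Um E (u y) * (deriv ^^ 2) \<psi> y
              - u y * deriv (\<lambda>t. t / 2 * \<psi> t) y) = 0))"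

text \<open>
  \<open>U\<close> and \<open>Q\<close> are pointwise representatives of the profile \<open>u\<close> and of its flux. The flux is the weak
  derivative of \<open>A \<circ> U\<close>; it is required to equal \<open>D(U) U'\<close> at each point where \<open>U\<close> is
  differentiable. Where \<open>D\<close> degenerates, \<open>U\<close> and \<open>Q\<close> may jump. By the equation, \<open>Q + (y/2) U\<close> has
  weak derivative \<open>U/2\<close>; asking this combination to be continuous determines \<open>Q\<close> everywhere
  once \<open>U\<close> is chosen, and in particular excludes an arbitrary value \<open>Q(0)\<close>.
\<close>

definition profile_flux_representatives ::
    "(real \<Rightarrow> real) \<Rightarrow> real \<Rightarrow> (real \<Rightarrow> real) \<Rightarrow> (real \<Rightarrow> real) \<Rightarrow> (real \<Rightarrow> real) \<Rightarrow> bool" where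
  "profile_flux_representatives D Um u U Q \<longleftrightarrow>
     (AE y in lebesgue. U y = u y) \<and> mono U \<and>
     has_weak_derivative (\<lambda>y. primitive_from Um D (U y)) Q \<and>
     (\<forall>y. U differentiable (at y) \<longrightarrow> Q y = D (U y) * deriv U y) \<and>
     continuous_on UNIV (\<lambda>y. Q y + y / 2 * U y)"

end

theory Submission
  imports Defs
begin

text \<open>
  Write \<open>A\<close> for the primitive of the (extended) diffusivity and \<open>a\<close> for the continuous
  representative of \<open>A \<circ> u\<close>. Integrating the weak equation once turns it into
  \<open>u = step + v'\<close> and \<open>a' = Q = (v - y (u - step)) / 2\<close> almost everywhere, with \<open>v\<close> locally
  absolutely continuous; square integrability of \<open>v\<close> and of \<open>u - step\<close> fixes the constant of
  integration (lemma \<open>weak_profile_equation\<close>).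
  Where the diffusivity vanishes, \<open>u\<close> itself may jump, so only \<open>v\<close> and \<open>a\<close> are at hand as
  continuous functions.

  Monotonicity is read off from this system on a half line \<open>y > 0\<close>, without a uniqueness theorem.
  Put \<open>m = U\<^sub>+ + v / y\<close>. Then \<open>y m' = u - m\<close> and \<open>a' = - (y / 2) (u - m)\<close>, so \<open>m\<close> and \<open>a\<close>
  always move in opposite directions. Where \<open>A m > a\<close> one has \<open>u < m\<close>, hence \<open>m\<close> falls, \<open>a\<close>
  rises and the gap \<open>A m - a\<close> shrinks; the case \<open>A m < a\<close> is symmetric, and where the gap
  vanishes on a ray, \<open>m\<close> is constant and \<open>u = U\<^sub>+\<close>. Therefore the gap never changes sign, and the
  solution either rises to \<open>U\<^sub>+\<close> with \<open>v 0 > 0\<close>, or it does not rise and then \<open>v 0 \<le> 0\<close> and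
  \<open>A U\<^sub>+ \<le> a 0\<close> (lemma \<open>dichotomy\<close>). The reflection \<open>y \<mapsto> - u (- y)\<close> preserves \<open>v 0\<close>, so both
  half lines are in the same case; the second one would give \<open>A U\<^sub>+ \<le> a 0 \<le> A U\<^sub>-\<close>, which
  is impossible because \<open>D\<close> is not identically zero. Hence \<open>u\<close> is nondecreasing off a null
  set and \<open>U\<^sub>- < U 0 < U\<^sub>+\<close>.

  For the estimates it suffices to treat \<open>y \<ge> 0\<close>. Monotonicity of \<open>U\<close> gives the finite-increment
  versions of \<open>dQ = - (y / 2) dU\<close> and \<open>dU \<ge> (Q / D\<^sup>*) dy\<close>, namely
  \<open>Q(s) - Q(t) \<ge> (s / 2) (U(t) - U(s))\<close> and \<open>U(t) - U(s) \<ge> (t - s) Q(t) / D\<^sup>*\<close> for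
  \<open>0 \<le> s \<le> t\<close>, which together with \<open>Q(t) \<ge> (t / 2) (U\<^sub>+ - U(t))\<close> yield
  \<open>p(t) (1 + s (t - s) / (2 D\<^sup>*)) \<le> p(s)\<close> both for \<open>p = Q\<close> and for \<open>p = U\<^sub>+ - U\<close>. Multiplying
  these factors over finer and finer partitions produces the Gaussian
  (lemma \<open>gaussian_decay_if_infinitesimal_decay\<close>). The bounds on \<open>Q 0 = v 0 / 2\<close> come from
  \<open>\<integral> (U\<^sub>+ - s) D(s) ds = \<integral> (U\<^sub>+ - U) Q dy \<le> Q 0 * \<integral> (U\<^sub>+ - U) dy = Q 0 * v 0\<close>
  and from \<open>\<integral> D ds = \<integral> Q dy = \<integral> v dy\<close>, where \<open>s\<close> runs from \<open>U 0\<close> to \<open>U\<^sub>+\<close> and \<open>y\<close> over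
  the half line; the last integral is at least the area of the
  triangle cut off by the line \<open>v 0 - (U\<^sub>+ - U 0) y\<close>, which lies below \<open>v\<close>.
\<close>

section \<open>Indefinite Lebesgue integrals\<close>

text \<open>
  Over \<open>n\<close> equal pieces of the interval the increments of \<open>f\<close> add up to at most
  \<open>(b - a) * (g b - g a) / n\<close>. The error weight \<open>g\<close> may be discontinuous, which makes this a
  substitute for differentiation when \<open>f\<close> involves a profile with jumps.
\<close>

lemma nonincreasing_if_quadratically_small:
  fixes f g :: "real \<Rightarrow> real"
  assumes "a \<le> b"
    and step: "\<And>s t. a \<le> s \<Longrightarrow> s \<le> t \<Longrightarrow> t \<le> b \<Longrightarrow> f t - f s \<le> (t - s) * (g t - g s)"
  shows "f b \<le> f a"
proof -
  have bound: "f b - f a \<le> (b - a) / real (Suc n) * (g b - g a)" for n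
  proof -
    define h where "h = (b - a) / real (Suc n)"
    define x where "x k = a + real k * h" for k
    have h0: "0 \<le> h" using \<open>a \<le> b\<close> by (simp add: h_def)
    have x_end: "x (Suc n) = b" "x 0 = a" by (auto simp: x_def h_def)
    have x_le: "x k \<le> b" if "k \<le> Suc n" for k
    proof -
      have "real k * h \<le> real (Suc n) * h" using that h0 by (intro mult_right_mono) auto
      then show ?thesis using x_end(1) by (simp add: x_def)
    qed
    have "f b - f a = (\<Sum>k<Suc n. f (x (Suc k)) - f (x k))"
      by (subst sum_lessThan_telescope) (simp only: x_end)
    also have "\<dots> \<le> (\<Sum>k<Suc n. h * (g (x (Suc k)) - g (x k)))"
    proof (rule sum_mono)
      fix k assume "k \<in> {..<Suc n}"
      then have "x (Suc k) \<le> b" by (intro x_le) auto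
      moreover have "a \<le> x k" "x k \<le> x (Suc k)" "x (Suc k) - x k = h"
        using h0 by (auto simp: x_def algebra_simps)
      ultimately show "f (x (Suc k)) - f (x k) \<le> h * (g (x (Suc k)) - g (x k))"
        using step[of "x k" "x (Suc k)"] by simp
    qed
    also have "\<dots> = h * (g b - g a)"
      unfolding sum_distrib_left[symmetric]
      by (subst sum_lessThan_telescope) (simp only: x_end)
    finally show ?thesis by (simp add: h_def)
  qed
  have "(\<lambda>n. (b - a) / real (Suc n) * (g b - g a)) \<longlonglongrightarrow> 0 * (g b - g a)"
    by (intro tendsto_mult tendsto_const) (rule LIMSEQ_Suc[OF lim_const_over_n])
  from LIMSEQ_le_const[OF this, of "f b - f a"] bound show ?thesis by auto
qed

text \<open>
  On an interval \<open>S\<close> this is local absolute continuity of \<open>F\<close> with almost everywhere derivative \<open>f\<close>.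
  The set is a parameter because the same notion is used on half lines and on the whole line.
\<close>

definition indefinite_integral_on :: "real set \<Rightarrow> (real \<Rightarrow> real) \<Rightarrow> (real \<Rightarrow> real) \<Rightarrow> bool" where
  "indefinite_integral_on S f F \<longleftrightarrow>
     (\<forall>s\<in>S. \<forall>t\<in>S. s \<le> t \<longrightarrow> f absolutely_integrable_on {s..t} \<and> (f has_integral (F t - F s)) {s..t})"

lemma indefinite_integral_onD:
  assumes "indefinite_integral_on S f F" "s \<in> S" "t \<in> S" "s \<le> t"
  shows "f absolutely_integrable_on {s..t}" "(f has_integral (F t - F s)) {s..t}"
    "f integrable_on {s..t}" "integral {s..t} f = F t - F s"
  using assms by (auto simp: indefinite_integral_on_def)

lemma indefinite_integral_on_subset:
  "indefinite_integral_on S f F \<Longrightarrow> T \<subseteq> S \<Longrightarrow> indefinite_integral_on T f F"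
  by (auto simp: indefinite_integral_on_def)

lemma indefinite_integral_on_add:
  "indefinite_integral_on S f F \<Longrightarrow> indefinite_integral_on S g G \<Longrightarrow>
   indefinite_integral_on S (\<lambda>x. f x + g x) (\<lambda>x. F x + G x)"
  unfolding indefinite_integral_on_def
  by (auto intro!: has_integral_eq_rhs[OF has_integral_add] set_integral_add(1))

lemma indefinite_integral_on_cmult:
  "indefinite_integral_on S f F \<Longrightarrow> indefinite_integral_on S (\<lambda>x. c * f x) (\<lambda>x. c * F x)"
  unfolding indefinite_integral_on_def
  by (auto intro!: has_integral_eq_rhs[OF has_integral_mult_right] simp: right_diff_distrib)

lemma indefinite_integral_on_diff:
  "indefinite_integral_on S f F \<Longrightarrow> indefinite_integral_on S g G \<Longrightarrow>
   indefinite_integral_on S (\<lambda>x. f x - g x) (\<lambda>x. F x - G x)"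
  using indefinite_integral_on_add[OF _ indefinite_integral_on_cmult[where c="-1"], of S f F g G]
  by simp

lemma indefinite_integral_on_cong:
  assumes "indefinite_integral_on S f F" "is_interval S" "negligible N"
    "\<And>x. x \<in> S \<Longrightarrow> x \<notin> N \<Longrightarrow> f x = g x" "\<And>x. x \<in> S \<Longrightarrow> F x = G x"
  shows "indefinite_integral_on S g G"
  unfolding indefinite_integral_on_def
proof (intro ballI impI)
  fix s t assume st: "s \<in> S" "t \<in> S" "s \<le> t"
  then have sub: "{s..t} \<subseteq> S" using assms(2) by (meson atLeastAtMost_iff is_interval_1 subsetI)
  have eq: "g x = f x" if "x \<in> {s..t} - N" for x using that assms(4) sub by fastforce
  show "g absolutely_integrable_on {s..t} \<and> (g has_integral (G t - G s)) {s..t}"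
    using absolutely_integrable_spike[OF indefinite_integral_onD(1)[OF assms(1) st] assms(3)]
      has_integral_spike[OF assms(3) _ indefinite_integral_onD(2)[OF assms(1) st]] eq assms(5) st
    by auto
qed

lemma indefinite_integral_on_derivative:
  assumes "is_interval S"
    and der: "\<And>x. x \<in> S \<Longrightarrow> (F has_real_derivative f x) (at x within S)"
    and cont: "continuous_on S f"
  shows "indefinite_integral_on S f F"
  unfolding indefinite_integral_on_def
proof (intro ballI impI)
  fix s t assume st: "s \<in> S" "t \<in> S" "s \<le> t"
  then have sub: "{s..t} \<subseteq> S" using assms(1) by (meson atLeastAtMost_iff is_interval_1 subsetI)
  have "f absolutely_integrable_on {s..t}"
    by (rule absolutely_integrable_continuous_real) (rule continuous_on_subset[OF cont sub])
  moreover have "(f has_integral (F t - F s)) {s..t}"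
    by (rule fundamental_theorem_of_calculus[OF st(3)])
      (meson der has_field_derivative_subset has_real_derivative_iff_has_vector_derivative sub subsetD)
  ultimately show "f absolutely_integrable_on {s..t} \<and> (f has_integral (F t - F s)) {s..t}" by simp
qed

lemma indefinite_integral_on_mono:
  assumes "indefinite_integral_on S f F" "indefinite_integral_on S g G" "negligible N"
    "s \<in> S" "t \<in> S" "s \<le> t" and le: "\<And>x. s \<le> x \<Longrightarrow> x \<le> t \<Longrightarrow> x \<notin> N \<Longrightarrow> f x \<le> g x"
  shows "F t - F s \<le> G t - G s"
proof -
  note f = indefinite_integral_onD(2)[OF assms(1,4-6)] and g = indefinite_integral_onD(2)[OF assms(2,4-6)]
  have "((\<lambda>x. if x \<in> N then g x else f x) has_integral (F t - F s)) {s..t}"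
    by (rule has_integral_spike[OF assms(3) _ f]) auto
  then show ?thesis by (rule has_integral_le[OF _ g]) (use le in auto)
qed

lemma indefinite_integral_on_continuous:
  assumes "indefinite_integral_on {a..b} f F"
  shows "continuous_on {a..b} F"
proof (cases "a \<le> b")
  case True
  have "continuous_on {a..b} (\<lambda>x. F a + integral {a..x} f)"
    using indefinite_integral_onD(3)[OF assms, of a b] True
    by (intro continuous_intros indefinite_integral_continuous_1) auto
  moreover have "F a + integral {a..x} f = F x" if "x \<in> {a..b}" for x
    using indefinite_integral_onD(4)[OF assms, of a x] that by simp
  ultimately show ?thesis by (rule continuous_on_eq)
qed auto

text \<open>
  The increment of \<open>F * g\<close> over \<open>{s..t}\<close> differs from the integral of the claimed density by at most
  \<open>(t - s)\<close> times a multiple of the integral of \<open>\<bar>f\<bar>\<close> over \<open>{s..t}\<close>: in \<open>f * g\<close> the factor \<open>g\<close> is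
  replaced by \<open>g t\<close>, in \<open>F * g'\<close> the factor \<open>F\<close> by \<open>F s\<close>. Such errors are quadratically small, so the difference
  is constant.
\<close>

lemma indefinite_integral_on_mult_Icc:
  assumes F: "indefinite_integral_on {a..b} f F"
    and g: "\<And>x. x \<in> {a..b} \<Longrightarrow> (g has_real_derivative g' x) (at x within {a..b})"
    and g': "continuous_on {a..b} g'"
  shows "indefinite_integral_on {a..b} (\<lambda>x. F x * g' x + f x * g x) (\<lambda>x. F x * g x)"
proof -
  have G: "indefinite_integral_on {a..b} g' g"
    by (rule indefinite_integral_on_derivative) (use g g' in \<open>auto simp: is_interval_cc\<close>)
  note contF = indefinite_integral_on_continuous[OF F] and contg = indefinite_integral_on_continuous[OF G]
  define h where "h = (\<lambda>x. F x * g' x + f x * g x)"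
  have abs_h: "h absolutely_integrable_on {s..t}" if "s \<in> {a..b}" "t \<in> {a..b}" "s \<le> t" for s t
  proof -
    have sub: "{s..t} \<subseteq> {a..b}" using that by auto
    have "(\<lambda>x. F x * g' x) absolutely_integrable_on {s..t}"
      by (intro absolutely_integrable_continuous_real continuous_intros
          continuous_on_subset[OF contF sub] continuous_on_subset[OF g' sub])
    moreover have "(\<lambda>x. g x * f x) absolutely_integrable_on {s..t}"
    proof (rule absolutely_integrable_bounded_measurable_product_real)
      show "g \<in> borel_measurable (lebesgue_on {s..t})"
        by (intro continuous_imp_measurable_on_sets_lebesgue continuous_on_subset[OF contg sub]) auto
      show "bounded (g ` {s..t})"
        by (intro compact_imp_bounded compact_continuous_image continuous_on_subset[OF contg sub]) auto
    qed (use indefinite_integral_onD(1)[OF F that] in auto)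
    ultimately show ?thesis
      unfolding h_def by (intro set_integral_add(1)) (simp_all add: mult.commute)
  qed
  obtain M where M: "\<And>x. x \<in> {a..b} \<Longrightarrow> \<bar>g' x\<bar> \<le> M"
    using compact_imp_bounded[OF compact_continuous_image[OF g' compact_Icc]]
    by (metis bounded_real imageI)
  have key: "\<bar>(F t * g t - F s * g s) - integral {s..t} h\<bar>
      \<le> (t - s) * (2 * M * integral {s..t} (\<lambda>x. \<bar>f x\<bar>))"
    if st: "s \<in> {a..b}" "t \<in> {a..b}" "s \<le> t" for s t
  proof -
    define L where "L = integral {s..t} (\<lambda>x. \<bar>f x\<bar>)"
    have M0: "0 \<le> M" using M[OF st(1)] by linarith
    have sub: "x \<in> {a..b}" if "x \<in> {s..t}" for x using that st by auto
    note f_int = indefinite_integral_onD(2)[OF F st] and g_int = indefinite_integral_onD(2)[OF G st]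
    have fa: "(\<lambda>x. \<bar>f x\<bar>) integrable_on {s..t}"
      using indefinite_integral_onD(1)[OF F st] by (auto simp: absolutely_integrable_on_def)
    have FL: "\<bar>F x - F s\<bar> \<le> L" if "x \<in> {s..t}" for x
    proof -
      have "\<bar>F x - F s\<bar> = norm (integral {s..x} f)"
        using indefinite_integral_onD(4)[OF F, of s x] st that by auto
      also have "\<dots> \<le> integral {s..x} (\<lambda>x. \<bar>f x\<bar>)"
        using that by (intro integral_norm_bound_integral indefinite_integral_onD(3)[OF F]
            integrable_on_subinterval[OF fa]) (use st in auto)
      also have "\<dots> \<le> L"
        unfolding L_def using that by (intro integral_subset_le integrable_on_subinterval[OF fa] fa) auto
      finally show ?thesis .
    qed
    have gM: "\<bar>g t - g x\<bar> \<le> M * (t - s)" if "x \<in> {s..t}" for x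
    proof -
      have "\<bar>g t - g x\<bar> \<le> M * (t - x)"
        using field_differentiable_bound[of "{a..b}" g g' M t x] g M sub[OF that] st that
        by (auto simp: convex_real_interval)
      also have "\<dots> \<le> M * (t - s)" using that M0 by (intro mult_left_mono) auto
      finally show ?thesis .
    qed
    have 1: "((\<lambda>x. g t * f x + F s * g' x - h x) has_integral
        (g t * (F t - F s) + F s * (g t - g s) - integral {s..t} h)) {s..t}"
      by (intro has_integral_diff has_integral_add has_integral_mult_right f_int g_int
          integrable_integral set_lebesgue_integral_eq_integral(1)[OF abs_h[OF st]])
    have 2: "((\<lambda>x. M * (t - s) * \<bar>f x\<bar> + L * M) has_integral
        (M * (t - s) * L + L * M * (t - s))) {s..t}"
      unfolding L_def using st(3)
      by (intro has_integral_add has_integral_mult_right integrable_integral fa)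
        (use has_integral_const_real[of "L * M" s t] st(3) in \<open>simp add: L_def algebra_simps\<close>)
    have "norm (g t * (F t - F s) + F s * (g t - g s) - integral {s..t} h)
        \<le> M * (t - s) * L + L * M * (t - s)"
      unfolding 1[THEN integral_unique, symmetric] 2[THEN integral_unique, symmetric]
    proof (rule integral_norm_bound_integral)
      fix x assume x: "x \<in> {s..t}"
      have "g t * f x + F s * g' x - h x = (g t - g x) * f x + (F s - F x) * g' x"
        by (simp add: h_def algebra_simps)
      also have "\<bar>\<dots>\<bar> \<le> \<bar>g t - g x\<bar> * \<bar>f x\<bar> + \<bar>F s - F x\<bar> * \<bar>g' x\<bar>"
        by (metis abs_mult abs_triangle_ineq)
      also have "\<dots> \<le> M * (t - s) * \<bar>f x\<bar> + L * M"
        using FL[OF x] by (intro add_mono mult_right_mono gM[OF x] mult_mono M sub[OF x]) auto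
      finally show "norm (g t * f x + F s * g' x - h x) \<le> M * (t - s) * \<bar>f x\<bar> + L * M" by simp
    qed (use 1 2 in blast)+
    then show ?thesis by (simp add: L_def algebra_simps)
  qed
  have "indefinite_integral_on {a..b} h (\<lambda>x. F x * g x)"
    unfolding indefinite_integral_on_def
  proof (intro ballI impI conjI)
    fix s t assume st: "s \<in> {a..b}" "t \<in> {a..b}" "s \<le> t"
    show "h absolutely_integrable_on {s..t}" by (rule abs_h[OF st])
    have h_int: "h integrable_on {s..t}" using abs_h[OF st] by (rule set_lebesgue_integral_eq_integral(1))
    have fa: "(\<lambda>x. \<bar>f x\<bar>) integrable_on {s..t}"
      using indefinite_integral_onD(1)[OF F st] by (auto simp: absolutely_integrable_on_def)
    define n where "n x = F x * g x - integral {s..x} h" for x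
    define l where "l x = 2 * M * integral {s..x} (\<lambda>x. \<bar>f x\<bar>)" for x
    have small: "\<bar>n y - n x\<bar> \<le> (y - x) * (l y - l x)" if xy: "s \<le> x" "x \<le> y" "y \<le> t" for x y
    proof -
      have i1: "integral {s..x} h + integral {x..y} h = integral {s..y} h"
        by (rule Henstock_Kurzweil_Integration.integral_combine) (use xy in \<open>auto intro: integrable_on_subinterval[OF h_int]\<close>)
      have i2: "integral {s..x} (\<lambda>x. \<bar>f x\<bar>) + integral {x..y} (\<lambda>x. \<bar>f x\<bar>)
          = integral {s..y} (\<lambda>x. \<bar>f x\<bar>)"
        by (rule Henstock_Kurzweil_Integration.integral_combine) (use xy in \<open>auto intro: integrable_on_subinterval[OF fa]\<close>)
      have "n y - n x = (F y * g y - F x * g x) - integral {x..y} h"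
        using i1 by (simp add: n_def)
      moreover have "l y - l x = 2 * M * integral {x..y} (\<lambda>x. \<bar>f x\<bar>)"
        unfolding l_def i2[symmetric] by (simp add: algebra_simps)
      ultimately show ?thesis using key[of x y] xy st by auto
    qed
    have "n t \<le> n s"
      by (rule nonincreasing_if_quadratically_small[OF st(3), where g=l]) (use small in fastforce)
    moreover have "- n t \<le> - n s"
      by (rule nonincreasing_if_quadratically_small[OF st(3), where g=l]) (use small in fastforce)
    ultimately have "integral {s..t} h = F t * g t - F s * g s" by (simp add: n_def)
    then show "(h has_integral (F t * g t - F s * g s)) {s..t}"
      using h_int by (metis integrable_integral)
  qed
  then show ?thesis by (simp add: h_def)
qed

lemma indefinite_integral_on_mult:
  assumes F: "indefinite_integral_on S f F" and S: "is_interval S"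
    and g: "\<And>x. x \<in> S \<Longrightarrow> (g has_real_derivative g' x) (at x within S)"
    and g': "continuous_on S g'"
  shows "indefinite_integral_on S (\<lambda>x. F x * g' x + f x * g x) (\<lambda>x. F x * g x)"
  unfolding indefinite_integral_on_def
proof (intro ballI impI)
  fix s t assume st: "s \<in> S" "t \<in> S" "s \<le> t"
  then have sub: "{s..t} \<subseteq> S" using S by (meson atLeastAtMost_iff is_interval_1 subsetI)
  have "indefinite_integral_on {s..t} (\<lambda>x. F x * g' x + f x * g x) (\<lambda>x. F x * g x)"
  proof (rule indefinite_integral_on_mult_Icc[OF indefinite_integral_on_subset[OF F sub]])
    show "(g has_real_derivative g' x) (at x within {s..t})" if "x \<in> {s..t}" for x
      using DERIV_subset[OF g sub] sub that by blast
  qed (rule continuous_on_subset[OF g' sub])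
  then show "(\<lambda>x. F x * g' x + f x * g x) absolutely_integrable_on {s..t} \<and>
      ((\<lambda>x. F x * g' x + f x * g x) has_integral F t * g t - F s * g s) {s..t}"
    using st by (simp add: indefinite_integral_on_def)
qed

lemma indefinite_integral_on_reflect:
  assumes "indefinite_integral_on S f F" "\<And>x. x \<in> T \<Longrightarrow> - x \<in> S"
  shows "indefinite_integral_on T (\<lambda>x. f (- x)) (\<lambda>x. - F (- x))"
  unfolding indefinite_integral_on_def
proof (intro ballI impI)
  fix s t assume st: "s \<in> T" "t \<in> T" "s \<le> t"
  then have *: "- t \<in> S" "- s \<in> S" "- t \<le> - s" using assms(2) by auto
  from indefinite_integral_onD(1,2)[OF assms(1) *]
  show "(\<lambda>x. f (- x)) absolutely_integrable_on {s..t} \<and>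
      ((\<lambda>x. f (- x)) has_integral - F (- t) - - F (- s)) {s..t}"
    using absolutely_integrable_reflect_real[where f=f and a="- t" and b="- s"]
      has_integral_reflect_real[where f=f and i="F (- s) - F (- t)" and a="- t" and b="- s"] by simp
qed

text \<open>
  By Lebesgue differentiation, \<open>f\<close> is almost everywhere the limit of its means over shrinking intervals.
\<close>

lemma AE_zero_if_integrals_zero:
  fixes f :: "real \<Rightarrow> real"
  assumes "\<And>s t. s \<le> t \<Longrightarrow> (f has_integral 0) {s..t}"
  shows "negligible {x. f x \<noteq> 0}"
proof -
  have 0: "(f has_integral 0) (cbox s t)" for s t
    using assms[of s t] by (cases "s \<le> t") auto
  obtain N where N: "negligible N" and
    diff: "\<And>x e. x \<notin> N \<Longrightarrow> 0 < e \<Longrightarrow> \<exists>d>0. \<forall>h. 0 < h \<and> h < d \<longrightarrow>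
        norm (integral (cbox x (x + h *\<^sub>R One)) f /\<^sub>R h ^ DIM(real) - f x) < e"
    using integrable_ccontinuous_explicit[of f] 0 by blast
  have "f x = 0" if x: "x \<notin> N" for x
  proof (rule ccontr)
    assume "f x \<noteq> 0"
    then obtain d where "0 < d" "\<And>h. 0 < h \<Longrightarrow> h < d \<Longrightarrow>
        norm (integral (cbox x (x + h *\<^sub>R One)) f /\<^sub>R h ^ DIM(real) - f x) < \<bar>f x\<bar>"
      using diff[OF x, of "\<bar>f x\<bar>"] by auto
    from this(2)[of "d/2"] this(1) show False
      using integral_unique[OF assms[of x "x + d/2"]] by simp
  qed
  then show ?thesis by (intro negligible_subset[OF N]) auto
qed

lemma indefinite_integral_on_derivative_at:
  assumes F: "indefinite_integral_on UNIV f F" and cont: "isCont f x"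
  shows "(F has_real_derivative f x) (at x)"
proof -
  have "((\<lambda>y. integral {x-1..y} f) has_vector_derivative f x) (at x within ({x-1..x+1} - {}))"
    by (rule integral_has_vector_derivative_continuous_at)
      (use indefinite_integral_onD(3)[OF F] cont continuous_at_imp_continuous_at_within in auto)
  then have "((\<lambda>y. integral {x-1..y} f) has_real_derivative f x) (at x within {x-1..x+1})"
    by (simp add: has_real_derivative_iff_has_vector_derivative)
  then have "((\<lambda>y. integral {x-1..y} f + F (x-1)) has_real_derivative f x) (at x within {x-1..x+1})"
    by (auto intro!: derivative_eq_intros)
  then have "(F has_real_derivative f x) (at x within {x-1..x+1})"
    by (rule has_field_derivative_transform_within[of _ _ _ _ 1])
      (auto simp: indefinite_integral_onD(4)[OF F])
  then show ?thesis by (subst (asm) at_within_interior) (auto simp: interior_atLeastAtMost_real)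
qed

text \<open>
  A nonnegative function with vanishing integral is zero almost everywhere, which contradicts
  positivity on an interval of positive length.
\<close>

lemma indefinite_integral_on_strict_mono:
  assumes F: "indefinite_integral_on S f F" and N: "negligible N" and st: "s \<in> S" "t \<in> S" "s < t"
    and pos: "\<And>x. s \<le> x \<Longrightarrow> x \<le> t \<Longrightarrow> x \<notin> N \<Longrightarrow> 0 < f x"
  shows "F s < F t"
proof (rule ccontr)
  assume "\<not> F s < F t"
  note int = indefinite_integral_onD[OF F st(1,2) less_imp_le[OF st(3)]]
  define g where "g = (\<lambda>x. indicator {s..t} x *\<^sub>R f x)"
  have "integrable lebesgue g" using int(1) by (simp add: g_def set_integrable_def)
  have AE_N: "AE x in lebesgue. x \<notin> N"
    using N by (auto simp: negligible_iff_null_sets intro: AE_not_in)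
  have nonneg: "AE x in lebesgue. 0 \<le> g x"
    using AE_N by eventually_elim (use pos in \<open>auto simp: g_def indicator_def less_imp_le\<close>)
  have "integral\<^sup>L lebesgue g = F t - F s"
    using set_lebesgue_integral_eq_integral(2)[OF int(1)] int(4) by (simp add: set_lebesgue_integral_def g_def)
  then have "integral\<^sup>L lebesgue g = 0"
    using \<open>\<not> F s < F t\<close> integral_nonneg_AE[OF nonneg] by linarith
  then have "AE x in lebesgue. g x = 0"
    using integral_nonneg_eq_0_iff_AE[OF \<open>integrable lebesgue g\<close> nonneg] by blast
  with AE_N have "AE x in lebesgue. x \<notin> {s..t}"
  proof eventually_elim
    case (elim x)
    then show ?case using pos[of x] by (auto simp: g_def indicator_def)
  qed
  moreover have "{s..t} \<in> sets lebesgue" by simp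
  ultimately have "negligible {s..t}"
    unfolding negligible_iff_null_sets using AE_iff_null_sets by blast
  then show False using negligible_interval(1)[of s t] st(3) by simp
qed

lemma continuous_on_atLeast_if_Icc:
  fixes F :: "real \<Rightarrow> real"
  assumes "\<And>b. continuous_on {a..b} F"
  shows "continuous_on {a..} F"
  unfolding continuous_on_eq_continuous_within
proof
  fix x assume x: "x \<in> {a..}"
  then have "continuous (at x within {a..x+1}) F"
    using assms[of "x+1"] by (auto simp: continuous_on_eq_continuous_within)
  moreover have "at x within {a..} = at x within {a..x+1}"
    by (rule at_within_nhd[of x "{..<x+1}"]) auto
  ultimately show "continuous (at x within {a..}) F" by simp
qed

lemma has_integral_zero_imp_AE_zero_atLeast:
  fixes f :: "real \<Rightarrow> real"
  assumes zero: "\<And>s t. z \<le> s \<Longrightarrow> s \<le> t \<Longrightarrow> (f has_integral 0) {s..t}"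
  shows "negligible {x. z \<le> x \<and> f x \<noteq> 0}"
proof -
  define g where "g x = (if z \<le> x then f x else 0)" for x
  have left: "(g has_integral 0) {s..t}" if "t \<le> z" for s t
    by (rule has_integral_spike[of "{z}" _ _ "\<lambda>_. 0"]) (use that in \<open>auto simp: g_def\<close>)
  have right: "(g has_integral 0) {s..t}" if "z \<le> s" "s \<le> t" for s t
    by (rule has_integral_eq[OF _ zero[OF that]]) (use that in \<open>auto simp: g_def\<close>)
  have "negligible {x. g x \<noteq> 0}"
  proof (rule AE_zero_if_integrals_zero)
    fix s t :: real assume st: "s \<le> t"
    consider "t \<le> z" | "z \<le> s" | "s \<le> z" "z \<le> t" by linarith
    then show "(g has_integral 0) {s..t}"
    proof cases
      case 3
      then show ?thesis using has_integral_combine[OF 3 left right] by simp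
    qed (use left right st in auto)
  qed
  then show ?thesis by (rule negligible_subset) (auto simp: g_def)
qed

section \<open>Test functions and the lemma of du Bois-Reymond\<close>

lemma L1_locI:
  assumes "\<And>R. f absolutely_integrable_on {-R..R}"
  shows "L1_loc f"
  unfolding L1_loc_def
proof (intro allI impI)
  fix K :: "real set" assume K: "compact K"
  then obtain R where "\<And>x. x \<in> K \<Longrightarrow> \<bar>x\<bar> \<le> R"
    using compact_imp_bounded bounded_real by metis
  then have "K \<subseteq> {-R..R}" by (force simp: abs_le_iff)
  then show "f absolutely_integrable_on K"
    using K by (intro set_integrable_subset[OF assms]) (auto simp: borel_compact)
qed

lemma L1_locD: "L1_loc f \<Longrightarrow> f absolutely_integrable_on {s..t}"
  by (simp add: L1_loc_def)

lemma L1_loc_continuous: "continuous_on UNIV f \<Longrightarrow> L1_loc f"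
  by (intro L1_locI absolutely_integrable_continuous_real) (metis continuous_on_subset subset_UNIV)

lemma L1_loc_indefinite_integral:
  assumes "L1_loc f"
  shows "\<exists>F. indefinite_integral_on UNIV f F \<and> F 0 = 0"
proof -
  define F where "F x = (if 0 \<le> x then integral {0..x} f else - integral {x..0} f)" for x :: real
  have int: "f integrable_on {s..t}" for s t
    using L1_locD[OF assms] by (rule set_lebesgue_integral_eq_integral(1))
  have "F t - F s = integral {s..t} f" if "s \<le> t" for s t
    using Henstock_Kurzweil_Integration.integral_combine[OF _ _ int, of s 0 t]
      Henstock_Kurzweil_Integration.integral_combine[OF _ _ int, of 0 s t]
      Henstock_Kurzweil_Integration.integral_combine[OF _ _ int, of s t 0] that
    by (cases "0 \<le> s"; cases "0 \<le> t") (simp_all add: F_def)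
  then show ?thesis
    using int L1_locD[OF assms]
    by (intro exI[of _ F]) (auto simp: indefinite_integral_on_def F_def has_integral_iff)
qed

lemma indefinite_integral_on_UNIV_continuous:
  assumes "indefinite_integral_on UNIV f F"
  shows "continuous_on UNIV F"
proof (rule continuous_at_imp_continuous_on, rule)
  fix x :: real
  have "continuous_on {x-1..x+1} F"
    by (rule indefinite_integral_on_continuous[OF indefinite_integral_on_subset[OF assms]]) simp
  then show "isCont F x" by (rule continuous_on_interior) (simp add: interior_atLeastAtMost_real)
qed

text \<open>
  Passes between the integrals over the whole line in the definition of weak derivatives and gauge
  integrals over a compact interval.
\<close>

lemma LINT_eq_integral_of_support:
  assumes "h absolutely_integrable_on {a..b}" "\<And>x. x \<notin> {a..b} \<Longrightarrow> h x = (0::real)"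
  shows "integrable lebesgue h" "(LINT x|lebesgue. h x) = integral {a..b} h"
proof -
  have eq: "indicator {a..b} x *\<^sub>R h x = h x" for x using assms(2)[of x] by (auto simp: indicator_def)
  show "integrable lebesgue h" using assms(1) unfolding set_integrable_def eq .
  show "(LINT x|lebesgue. h x) = integral {a..b} h"
    using set_lebesgue_integral_eq_integral(2)[OF assms(1)] unfolding set_lebesgue_integral_def eq .
qed

lemma Ck_c_bounded_support:
  assumes "Ck_c k f"
  obtains R where "0 < R" "\<And>x. R < \<bar>x\<bar> \<Longrightarrow> f x = 0"
proof -
  have "bounded {x. f x \<noteq> 0}"
    using assms by (auto simp: Ck_c_def intro: bounded_subset[OF compact_imp_bounded closure_subset])
  then obtain R where "R > 0" "\<And>x. f x \<noteq> 0 \<Longrightarrow> \<bar>x\<bar> \<le> R" by (auto simp: bounded_pos)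
  then show thesis by (intro that[of R]) (auto simp: not_le[symmetric])
qed

lemma Ck_c_SucI:
  assumes "\<And>x. (f has_real_derivative f' x) (at x)" "\<And>x. R < \<bar>x\<bar> \<Longrightarrow> f x = 0" "Ck_c k f'"
  shows "Ck_c (Suc k) f"
proof -
  have deriv: "deriv f = f'" using assms(1) by (auto intro!: DERIV_imp_deriv)
  have shift: "(deriv ^^ Suc j) f = (deriv ^^ j) f'" for j by (simp add: funpow_swap1 deriv)
  have "x \<in> {-R..R}" if "f x \<noteq> 0" for x
    using assms(2)[of x] that by (cases "R < \<bar>x\<bar>") auto
  then have "{x. f x \<noteq> 0} \<subseteq> {-R..R}" by blast
  then have "compact (closure {x. f x \<noteq> 0})"
    by (intro compact_closure[THEN iffD2] bounded_subset[OF bounded_closed_interval])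
  moreover have "(deriv ^^ j) f differentiable (at x)" if "j < Suc k" for j x
  proof (cases j)
    case 0
    then show ?thesis using assms(1)[of x] real_differentiable_def by auto
  next
    case (Suc i)
    then show ?thesis using assms(3) that unfolding Suc shift by (simp add: Ck_c_def)
  qed
  ultimately show ?thesis
    using assms(3) unfolding Ck_c_def shift by blast
qed

lemma Ck_c_0I:
  assumes "continuous_on UNIV f" "\<And>x. R < \<bar>x\<bar> \<Longrightarrow> f x = 0"
  shows "Ck_c 0 f"
proof -
  have "x \<in> {-R..R}" if "f x \<noteq> 0" for x
    using assms(2)[of x] that by (cases "R < \<bar>x\<bar>") auto
  then have "{x. f x \<noteq> 0} \<subseteq> {-R..R}" by blast
  then have "compact (closure {x. f x \<noteq> 0})"
    by (intro compact_closure[THEN iffD2] bounded_subset[OF bounded_closed_interval])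
  then show ?thesis using assms by (simp add: Ck_c_def)
qed

lemma Ck_c_SucD:
  assumes "Ck_c (Suc k) f"
  shows "(f has_real_derivative deriv f x) (at x)" "Ck_c k (deriv f)"
proof -
  have "f differentiable (at x)" for x using assms unfolding Ck_c_def by (metis funpow_0 zero_less_Suc)
  then show der: "(f has_real_derivative deriv f x) (at x)" for x
    by (simp add: DERIV_deriv_iff_real_differentiable)
  have shift: "(deriv ^^ Suc j) f = (deriv ^^ j) (deriv f)" for j by (simp add: funpow_swap1)
  have "(deriv ^^ j) (deriv f) differentiable (at x)" if "j < k" for j x
    using assms that unfolding Ck_c_def shift[symmetric] by (meson Suc_mono)
  moreover have "continuous_on UNIV ((deriv ^^ k) (deriv f))"
    using assms unfolding Ck_c_def shift[symmetric] by simp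
  moreover have "deriv f x = 0" if x: "x \<notin> closure {x. f x \<noteq> 0}" for x
  proof -
    have "\<forall>\<^sub>F y in nhds x. y \<notin> closure {x. f x \<noteq> 0}"
      using x by (intro eventually_nhds_in_open[of "- closure {x. f x \<noteq> 0}", simplified]) auto
    then have "\<forall>\<^sub>F y in nhds x. f y = 0"
    proof (rule eventually_mono)
      fix y assume "y \<notin> closure {x. f x \<noteq> 0}"
      then have "y \<notin> {x. f x \<noteq> 0}" using closure_subset by (rule contra_subsetD[rotated])
      then show "f y = 0" by simp
    qed
    then have "deriv f x = deriv (\<lambda>_. 0) x" by (intro deriv_cong_ev) auto
    then show ?thesis by simp
  qed
  then have "{x. deriv f x \<noteq> 0} \<subseteq> closure {x. f x \<noteq> 0}" by blast
  then have "compact (closure {x. deriv f x \<noteq> 0})"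
    using assms by (intro compact_closure[THEN iffD2] bounded_subset[OF compact_imp_bounded])
      (auto simp: Ck_c_def)
  ultimately show "Ck_c k (deriv f)" unfolding Ck_c_def by blast
qed

lemma Ck_c_Suc_imp_Ck_c:
  assumes "Ck_c (Suc k) f"
  shows "Ck_c k f"
  unfolding Ck_c_def
proof (intro conjI allI impI)
  show "(deriv ^^ j) f differentiable at x" if "j < k" for j x
    using assms that by (simp add: Ck_c_def)
  have "(deriv ^^ k) f differentiable (at x)" for x using assms unfolding Ck_c_def by blast
  then show "continuous_on UNIV ((deriv ^^ k) f)"
    by (intro continuous_at_imp_continuous_on ballI differentiable_imp_continuous_within)
  show "compact (closure {x. f x \<noteq> 0})" using assms by (simp add: Ck_c_def)
qed

lemma Ck_c_continuous:
  assumes "Ck_c k f"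
  shows "continuous_on UNIV f"
proof (cases k)
  case 0
  then show ?thesis using assms by (simp add: Ck_c_def)
next
  case (Suc j)
  then have "isCont f x" for x
    using assms Ck_c_SucD(1)[of j f x] DERIV_isCont by blast
  then show ?thesis by (simp add: continuous_at_imp_continuous_on)
qed

lemma Ck_c_diff_cmult:
  assumes "Ck_c k f" "Ck_c k g"
  shows "Ck_c k (\<lambda>x. f x - c * g x)"
  using assms
proof (induction k arbitrary: f g)
  case (0 f g)
  obtain R where R: "\<And>x. R < \<bar>x\<bar> \<Longrightarrow> f x = 0" using Ck_c_bounded_support[OF 0(1)] by blast
  obtain S where S: "\<And>x. S < \<bar>x\<bar> \<Longrightarrow> g x = 0" using Ck_c_bounded_support[OF 0(2)] by blast
  show ?case
  proof (rule Ck_c_0I[where R="max R S"])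
    show "continuous_on UNIV (\<lambda>x. f x - c * g x)"
      by (intro continuous_intros Ck_c_continuous[OF 0(1)] Ck_c_continuous[OF 0(2)])
  qed (use R S in auto)
next
  case (Suc k f g)
  obtain R where R: "\<And>x. R < \<bar>x\<bar> \<Longrightarrow> f x = 0" using Ck_c_bounded_support[OF Suc(2)] by blast
  obtain S where S: "\<And>x. S < \<bar>x\<bar> \<Longrightarrow> g x = 0" using Ck_c_bounded_support[OF Suc(3)] by blast
  show ?case
  proof (rule Ck_c_SucI[where R="max R S"])
    show "((\<lambda>x. f x - c * g x) has_real_derivative deriv f x - c * deriv g x) (at x)" for x
      by (intro DERIV_diff DERIV_cmult Ck_c_SucD[OF Suc(2)] Ck_c_SucD[OF Suc(3)])
    show "Ck_c k (\<lambda>x. deriv f x - c * deriv g x)"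
      by (intro Suc.IH Ck_c_SucD[OF Suc(2)] Ck_c_SucD[OF Suc(3)])
  qed (use R S in auto)
qed

lemma integrable_mult_Ck_c:
  assumes "L1_loc f" "Ck_c k h"
  shows "integrable lebesgue (\<lambda>x. f x * h x)"
proof -
  obtain R where R: "\<And>x. R < \<bar>x\<bar> \<Longrightarrow> h x = 0" using Ck_c_bounded_support[OF assms(2)] by blast
  have cont: "continuous_on {-R..R} h" using Ck_c_continuous[OF assms(2)] by (rule continuous_on_subset) simp
  have "(\<lambda>x. h x * f x) absolutely_integrable_on {-R..R}"
  proof (rule absolutely_integrable_bounded_measurable_product_real)
    show "h \<in> borel_measurable (lebesgue_on {-R..R})"
      by (intro continuous_imp_measurable_on_sets_lebesgue cont) auto
    show "bounded (h ` {-R..R})" by (intro compact_imp_bounded compact_continuous_image cont) auto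
  qed (use L1_locD[OF assms(1)] in auto)
  then have "(\<lambda>x. f x * h x) absolutely_integrable_on {-R..R}" by (simp only: mult.commute)
  moreover have "f x * h x = 0" if "x \<notin> {-R..R}" for x
  proof -
    have "R < \<bar>x\<bar>" using that by auto
    then show ?thesis by (simp add: R)
  qed
  ultimately show ?thesis by (rule LINT_eq_integral_of_support(1))
qed

lemma integrable_Ck_c: "Ck_c k h \<Longrightarrow> integrable lebesgue h"
  using integrable_mult_Ck_c[of "\<lambda>_. 1" k h] L1_loc_continuous[of "\<lambda>_. 1"] by simp

text \<open>
  Product rule for \<open>F * \<phi>\<close> on an interval at whose end points the test function vanishes.
\<close>

lemma has_weak_derivative_indefinite_integral:
  assumes F: "indefinite_integral_on UNIV f F"
  shows "has_weak_derivative F f"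
  unfolding has_weak_derivative_def
proof (intro conjI allI impI)
  show "L1_loc F" by (intro L1_loc_continuous indefinite_integral_on_UNIV_continuous[OF F])
  show f: "L1_loc f"
  proof (rule L1_locI)
    fix R :: real
    show "f absolutely_integrable_on {-R..R}"
      using indefinite_integral_onD(1)[OF F, of "-R" R]
      by (cases "-R \<le> R") (auto simp: set_integrable_def)
  qed
  fix \<phi> assume \<phi>: "Ck_c 1 \<phi>"
  then have \<phi>': "Ck_c (Suc 0) \<phi>" by simp
  obtain R where R: "0 < R" "\<And>x. R < \<bar>x\<bar> \<Longrightarrow> \<phi> x = 0" using Ck_c_bounded_support[OF \<phi>] by blast
  obtain S where S: "0 < S" "\<And>x. S < \<bar>x\<bar> \<Longrightarrow> deriv \<phi> x = 0"
    using Ck_c_bounded_support[OF Ck_c_SucD(2)[OF \<phi>']] by blast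
  define T where "T = max R S + 1"
  have prod: "indefinite_integral_on {-T..T} (\<lambda>x. F x * deriv \<phi> x + f x * \<phi> x) (\<lambda>x. F x * \<phi> x)"
    by (rule indefinite_integral_on_mult[OF indefinite_integral_on_subset[OF F]])
      (use Ck_c_SucD[OF \<phi>'] Ck_c_continuous in \<open>auto intro: DERIV_subset continuous_on_subset\<close>)
  have T: "-T \<in> {-T..T}" "T \<in> {-T..T}" "-T \<le> T" using R(1) S(1) by (auto simp: T_def)
  have zero: "\<phi> T = 0" "\<phi> (-T) = 0" using R S by (auto simp: T_def)
  have i: "integrable lebesgue (\<lambda>x. F x * deriv \<phi> x)" "integrable lebesgue (\<lambda>x. f x * \<phi> x)"
    using integrable_mult_Ck_c[OF \<open>L1_loc F\<close> Ck_c_SucD(2)[OF \<phi>']] integrable_mult_Ck_c[OF f \<phi>] by auto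
  have "(LINT x|lebesgue. F x * deriv \<phi> x) + (LINT x|lebesgue. f x * \<phi> x)
      = (LINT x|lebesgue. F x * deriv \<phi> x + f x * \<phi> x)"
    by (rule Bochner_Integration.integral_add[OF i, symmetric])
  also have "\<dots> = integral {-T..T} (\<lambda>x. F x * deriv \<phi> x + f x * \<phi> x)"
    by (rule LINT_eq_integral_of_support(2)[OF indefinite_integral_onD(1)[OF prod T]])
      (use R S in \<open>auto simp: T_def\<close>)
  also have "\<dots> = 0" using indefinite_integral_onD(4)[OF prod T] zero by simp
  finally show "(LINT x|lebesgue. F x * deriv \<phi> x) = - (LINT x|lebesgue. f x * \<phi> x)" by linarith
qed

text \<open>
  Trapezoidal test functions decrease to the indicator of \<open>{s..t}\<close>, so all interval integrals of \<open>g\<close>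
  vanish by dominated convergence.
\<close>

lemma AE_zero_if_orthogonal_to_continuous:
  assumes g: "L1_loc g" and orth: "\<And>h. Ck_c 0 h \<Longrightarrow> (LINT x|lebesgue. g x * h x) = 0"
  shows "negligible {x. g x \<noteq> 0}"
proof (rule AE_zero_if_integrals_zero)
  fix s t :: real assume "s \<le> t"
  define e where "e x = max 0 (max (s - x) (x - t))" for x
  define h where "h n x = max 0 (1 - real (Suc n) * e x)" for n x
  have e0: "0 \<le> e x" for x by (simp add: e_def)
  have h_supp: "h n x = 0" if "1 \<le> e x" for n x
  proof -
    have "1 \<le> real (Suc n) * e x"
      using mult_mono[of 1 "real (Suc n)" 1 "e x"] that by simp
    then show ?thesis by (simp only: h_def max_def) simp
  qed
  have h_bd: "\<bar>h n x\<bar> \<le> 1" for n x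
  proof -
    have "0 \<le> real (Suc n) * e x" using e0 by simp
    then show ?thesis by (simp only: h_def max_def) simp
  qed
  have C: "Ck_c 0 (h n)" for n
  proof (rule Ck_c_0I)
    show "continuous_on UNIV (h n)" unfolding h_def e_def by (intro continuous_intros)
    show "h n x = 0" if "\<bar>s\<bar> + \<bar>t\<bar> + 1 < \<bar>x\<bar>" for x
      by (rule h_supp) (use that in \<open>simp only: e_def; linarith\<close>)
  qed
  have h_supp': "h n x = 0" if "x \<notin> {s-1..t+1}" for n x
  proof (rule h_supp)
    have "x < s - 1 \<or> t + 1 < x" using that by auto
    then show "1 \<le> e x" unfolding e_def by linarith
  qed
  have lim: "(\<lambda>n. g x * h n x) \<longlonglongrightarrow> (if x \<in> {s..t} then g x else 0)" for x
  proof (cases "x \<in> {s..t}")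
    case True
    then have "e x = 0" by (auto simp: e_def)
    then show ?thesis using True by (simp add: h_def)
  next
    case False
    then have "x < s \<or> t < x" by auto
    then have "0 < e x" unfolding e_def by linarith
    then obtain N where N: "1 < real N * e x" using ex_less_of_nat_mult by blast
    have "h n x = 0" if "N \<le> n" for n
    proof -
      have "real N * e x \<le> real (Suc n) * e x" using that e0 by (intro mult_right_mono) auto
      then have "1 \<le> real (Suc n) * e x" using N by linarith
      then show ?thesis by (simp only: h_def max_def) simp
    qed
    then have "\<forall>\<^sub>F n in sequentially. g x * h n x = 0"
      unfolding eventually_sequentially by (metis mult_zero_right)
    then have "(\<lambda>n. g x * h n x) \<longlonglongrightarrow> 0" by (rule tendsto_eventually)
    then show ?thesis by (simp only: if_not_P[OF False])
  qed
  have gi: "g absolutely_integrable_on {s-1..t+1}" by (rule L1_locD[OF g])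
  have abs: "(\<lambda>x. g x * h n x) absolutely_integrable_on {s-1..t+1}" for n
    by (rule set_integrable_subset[of lebesgue UNIV])
      (use integrable_mult_Ck_c[OF g C] in \<open>auto simp: set_integrable_def\<close>)
  have zero: "integral {s-1..t+1} (\<lambda>x. g x * h n x) = 0" for n
    using LINT_eq_integral_of_support(2)[OF abs] orth[OF C[of n]] h_supp' by simp
  have "(\<lambda>n. integral {s-1..t+1} (\<lambda>x. g x * h n x)) \<longlonglongrightarrow>
      integral {s-1..t+1} (\<lambda>x. if x \<in> {s..t} then g x else 0)"
  proof (rule dominated_convergence(2))
    show "(\<lambda>x. g x * h n x) integrable_on {s-1..t+1}" for n
      using abs by (rule set_lebesgue_integral_eq_integral(1))
    show "(\<lambda>x. \<bar>g x\<bar>) integrable_on {s-1..t+1}" using gi by (auto simp: absolutely_integrable_on_def)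
    show "norm (g x * h n x) \<le> \<bar>g x\<bar>" for n x
      using mult_left_mono[OF h_bd, of "\<bar>g x\<bar>" n x] by (simp add: abs_mult)
  qed (rule lim)
  then have "integral {s-1..t+1} (\<lambda>x. if x \<in> {s..t} then g x else 0) = 0"
    unfolding zero by (simp add: LIMSEQ_const_iff)
  moreover have "{s..t} \<inter> {s-1..t+1} = {s..t}" by auto
  ultimately have "integral {s..t} g = 0" by (simp only: integral_restrict_Int)
  moreover have "g integrable_on {s..t}" using L1_locD[OF g] by (rule set_lebesgue_integral_eq_integral(1))
  ultimately show "(g has_integral 0) {s..t}" by (metis integrable_integral)
qed

lemma has_derivative_positive_part_squared:
  "((\<lambda>y::real. (max 0 y)\<^sup>2) has_real_derivative 2 * max 0 y) (at y)"
proof -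
  consider "y < 0" | "y = 0" | "y > 0" by linarith
  then show ?thesis
  proof cases
    case 1
    have "((\<lambda>_. 0) has_real_derivative 0) (at y)" by simp
    then show ?thesis
      using 1 by (rule_tac has_field_derivative_transform_within_open[of _ _ _ "{..<0}", THEN DERIV_cong]) auto
  next
    case 2
    have "(\<lambda>h::real. max 0 h) \<midarrow>0\<rightarrow> max 0 0" by (intro tendsto_intros)
    moreover have "\<forall>\<^sub>F h::real in at 0. max 0 h = ((max 0 (0 + h))\<^sup>2 - (max 0 0)\<^sup>2) / h"
      by (auto simp: eventually_at_filter power2_eq_square max_def)
    ultimately show ?thesis
      unfolding DERIV_def 2 by (simp add: tendsto_cong)
  next
    case 3
    have "((\<lambda>y. y\<^sup>2) has_real_derivative 2 * y) (at y)" by (auto intro!: derivative_eq_intros)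
    then show ?thesis
      using 3 by (rule_tac has_field_derivative_transform_within_open[of _ _ _ "{0<..}", THEN DERIV_cong]) auto
  qed
qed

text \<open>
  A single test function of nonzero mass; subtracting multiples of it from other test functions
  normalises their mean to zero.
\<close>

lemma Ck_c_bump:
  obtains \<eta> where "Ck_c 1 \<eta>" "(LINT x|lebesgue. \<eta> x) \<noteq> 0"
proof
  define \<eta> where "\<eta> x = (max 0 (1 - x\<^sup>2))\<^sup>2" for x :: real
  define \<eta>' where "\<eta>' x = (2 * max 0 (1 - x\<^sup>2)) * (0 - 2 * x)" for x :: real
  have supp: "max 0 (1 - x\<^sup>2) = 0" if "1 < \<bar>x\<bar>" for x :: real
  proof -
    from that have "1 \<le> \<bar>x\<bar>\<^sup>2" by (intro one_le_power) auto
    then show ?thesis by simp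
  qed
  have "Ck_c 0 \<eta>'"
    by (rule Ck_c_0I[where R=1]) (auto simp: \<eta>'_def dest: supp intro!: continuous_intros)
  moreover have "(\<eta> has_real_derivative \<eta>' x) (at x)" for x
    unfolding \<eta>_def \<eta>'_def
    by (rule DERIV_chain2[OF has_derivative_positive_part_squared]) (auto intro!: derivative_eq_intros)
  ultimately have "Ck_c (Suc 0) \<eta>"
    by (intro Ck_c_SucI[where R=1]) (use supp in \<open>auto simp: \<eta>_def\<close>)
  then show C: "Ck_c 1 \<eta>" by simp
  have cont: "continuous_on {-1..1} \<eta>" unfolding \<eta>_def by (intro continuous_intros)
  have "(LINT x|lebesgue. \<eta> x) = integral {-1..1} \<eta>"
    by (rule LINT_eq_integral_of_support(2)[OF absolutely_integrable_continuous_real[OF cont]])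
      (auto simp: \<eta>_def intro!: supp)
  moreover have "integral {-1..1} \<eta> \<noteq> 0"
  proof
    assume "integral {-1..1} \<eta> = 0"
    then have "\<forall>x\<in>{-1..1}. \<eta> x = 0" using integral_eq_0_iff[OF cont] by (simp add: \<eta>_def)
    then have "\<eta> 0 = 0" by simp
    then show False by (simp add: \<eta>_def)
  qed
  ultimately show "(LINT x|lebesgue. \<eta> x) \<noteq> 0" by simp
qed

text \<open>
  The vanishing mean is what makes the antiderivative compactly supported.
\<close>

lemma Ck_c_antiderivative:
  assumes g: "Ck_c k g" and zero: "(LINT x|lebesgue. g x) = 0"
  shows "\<exists>\<phi>. Ck_c (Suc k) \<phi> \<and> deriv \<phi> = g"
proof -
  obtain R where R: "0 < R" "\<And>x. R < \<bar>x\<bar> \<Longrightarrow> g x = 0" using Ck_c_bounded_support[OF g] by blast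
  have cont: "continuous_on UNIV g" by (rule Ck_c_continuous[OF g])
  obtain G where G: "indefinite_integral_on UNIV g G"
    using L1_loc_indefinite_integral[OF L1_loc_continuous[OF cont]] by blast
  define \<phi> where "\<phi> x = G x - G (-R)" for x
  have der: "(\<phi> has_real_derivative g x) (at x)" for x
    using DERIV_diff[OF indefinite_integral_on_derivative_at[OF G, of x] DERIV_const[of "G (-R)"]] cont
    by (simp add: \<phi>_def[abs_def] continuous_on_eq_continuous_at)
  have "\<phi> x = 0" if x: "R < \<bar>x\<bar>" for x
  proof (cases "x < -R")
    case True
    have "integral {x..-R} g = integral {x..-R} (\<lambda>_. 0)"
      by (rule integral_spike[of "{-R}"]) (use R in auto)
    then show ?thesis using indefinite_integral_onD(4)[OF G, of x "-R"] True by (simp add: \<phi>_def)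
  next
    case False
    have ai: "g absolutely_integrable_on {-R..x}"
      by (intro absolutely_integrable_continuous_real continuous_on_subset[OF cont]) simp
    have "integral {-R..x} g = 0"
      unfolding zero[symmetric]
      by (rule LINT_eq_integral_of_support(2)[OF ai, symmetric]) (use R x False in force)
    then show ?thesis using indefinite_integral_onD(4)[OF G, of "-R" x] False x R(1) by (simp add: \<phi>_def)
  qed
  then have "Ck_c (Suc k) \<phi>" by (rule Ck_c_SucI[OF der _ g])
  moreover have "deriv \<phi> = g" using der by (auto intro!: DERIV_imp_deriv)
  ultimately show ?thesis by blast
qed

text \<open>
  Every continuous test function minus the right multiple of the bump is a derivative \<open>deriv \<phi>\<close>.
  The constant is the mean of \<open>f\<close> with respect to the bump.
\<close>

lemma du_Bois_Reymond:
  assumes f: "L1_loc f" and orth: "\<And>\<phi>. Ck_c 1 \<phi> \<Longrightarrow> (LINT x|lebesgue. f x * deriv \<phi> x) = 0"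
  shows "\<exists>c. negligible {x. f x \<noteq> c}"
proof -
  obtain \<eta> where \<eta>1: "Ck_c 1 \<eta>" and m: "(LINT x|lebesgue. \<eta> x) \<noteq> 0" using Ck_c_bump by blast
  have \<eta>: "Ck_c 0 \<eta>"
    using Ck_c_bounded_support[OF \<eta>1] Ck_c_0I[OF Ck_c_continuous[OF \<eta>1]] by metis
  define c where "c = (LINT x|lebesgue. f x * \<eta> x) / (LINT x|lebesgue. \<eta> x)"
  have "negligible {x. f x - c \<noteq> 0}"
  proof (rule AE_zero_if_orthogonal_to_continuous)
    show "L1_loc (\<lambda>x. f x - c)"
      using f L1_loc_continuous[of "\<lambda>_. c"] by (auto simp: L1_loc_def intro: set_integral_diff(1))
    fix h assume h: "Ck_c 0 h"
    define d where "d = (LINT x|lebesgue. h x) / (LINT x|lebesgue. \<eta> x)"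
    note ints = integrable_Ck_c[OF h] integrable_Ck_c[OF \<eta>] integrable_mult_Ck_c[OF f h] integrable_mult_Ck_c[OF f \<eta>]
    have "(LINT x|lebesgue. h x - d * \<eta> x) = (LINT x|lebesgue. h x) - d * (LINT x|lebesgue. \<eta> x)"
      using ints by simp
    also have "\<dots> = 0" using m by (simp add: d_def)
    finally obtain \<phi> where \<phi>: "Ck_c 1 \<phi>" "deriv \<phi> = (\<lambda>x. h x - d * \<eta> x)"
      using Ck_c_antiderivative[OF Ck_c_diff_cmult[OF h \<eta>, of d]] by auto
    have "(LINT x|lebesgue. f x * h x) - d * (LINT x|lebesgue. f x * \<eta> x)
        = (LINT x|lebesgue. f x * h x - d * (f x * \<eta> x))" using ints by simp
    also have "\<dots> = (LINT x|lebesgue. f x * deriv \<phi> x)"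
      unfolding \<phi>(2) by (intro Bochner_Integration.integral_cong) (auto simp: algebra_simps)
    also have "\<dots> = 0" by (rule orth[OF \<phi>(1)])
    finally have 1: "(LINT x|lebesgue. f x * h x) = d * (LINT x|lebesgue. f x * \<eta> x)" by simp
    have "(LINT x|lebesgue. (f x - c) * h x) = (LINT x|lebesgue. f x * h x) - c * (LINT x|lebesgue. h x)"
      using ints by (simp add: left_diff_distrib)
    also have "\<dots> = 0" unfolding 1 by (simp add: c_def d_def)
    finally show "(LINT x|lebesgue. (f x - c) * h x) = 0" .
  qed
  then show ?thesis by auto
qed

text \<open>
  Testing \<open>f - d * x\<close> against \<open>deriv \<phi>\<close> reduces this to the first-order statement, as \<open>\<phi>\<close> minus a
  multiple of the bump is the derivative of some \<open>\<psi>\<close>. The slope \<open>d\<close> is forced by the bump, because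
  the identity has weak derivative \<open>1\<close>.
\<close>

lemma du_Bois_Reymond_second_order:
  assumes f: "L1_loc f" and orth: "\<And>\<psi>. Ck_c 2 \<psi> \<Longrightarrow> (LINT x|lebesgue. f x * (deriv ^^ 2) \<psi> x) = 0"
  shows "\<exists>c d. negligible {x. f x \<noteq> c + d * x}"
proof -
  obtain \<eta> where \<eta>: "Ck_c 1 \<eta>" and m: "(LINT x|lebesgue. \<eta> x) \<noteq> 0" using Ck_c_bump by blast
  have \<eta>': "Ck_c 0 (deriv \<eta>)" using Ck_c_SucD(2)[of 0] \<eta> by simp
  have id: "L1_loc (\<lambda>x. x)" by (intro L1_loc_continuous continuous_intros)
  have "indefinite_integral_on UNIV (\<lambda>_. 1) (\<lambda>x. x)"
    by (rule indefinite_integral_on_derivative) (auto intro!: derivative_eq_intros)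
  note wid = has_weak_derivative_indefinite_integral[OF this]
  define d where "d = - (LINT x|lebesgue. f x * deriv \<eta> x) / (LINT x|lebesgue. \<eta> x)"
  have L: "L1_loc (\<lambda>x. f x - d * x)"
    using f id by (auto simp: L1_loc_def intro!: set_integral_diff(1) set_integrable_mult_right)
  have "\<exists>c. negligible {x. f x - d * x \<noteq> c}"
  proof (rule du_Bois_Reymond[OF L])
    fix \<phi> assume \<phi>: "Ck_c 1 \<phi>"
    have \<phi>': "Ck_c 0 (deriv \<phi>)" using Ck_c_SucD(2)[of 0] \<phi> by simp
    define e where "e = (LINT x|lebesgue. \<phi> x) / (LINT x|lebesgue. \<eta> x)"
    have "(LINT x|lebesgue. \<phi> x - e * \<eta> x) = (LINT x|lebesgue. \<phi> x) - e * (LINT x|lebesgue. \<eta> x)"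
      using integrable_Ck_c[OF \<phi>] integrable_Ck_c[OF \<eta>] by simp
    also have "\<dots> = 0" using m by (simp add: e_def)
    finally obtain \<psi> where \<psi>: "Ck_c (Suc 1) \<psi>" "deriv \<psi> = (\<lambda>x. \<phi> x - e * \<eta> x)"
      using Ck_c_antiderivative[OF Ck_c_diff_cmult[OF \<phi> \<eta>, of e]] by auto
    have dd: "(deriv ^^ 2) \<psi> x = deriv \<phi> x - e * deriv \<eta> x" for x
      unfolding numeral_2_eq_2 funpow.simps o_def id_def \<psi>(2)
      using Ck_c_SucD(1)[of 0 \<phi> x] Ck_c_SucD(1)[of 0 \<eta> x] \<phi> \<eta>
      by (intro DERIV_imp_deriv DERIV_diff DERIV_cmult) auto
    note ints = integrable_mult_Ck_c[OF f \<phi>'] integrable_mult_Ck_c[OF f \<eta>'] integrable_mult_Ck_c[OF id \<phi>']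
    have "(LINT x|lebesgue. f x * deriv \<phi> x) - e * (LINT x|lebesgue. f x * deriv \<eta> x)
        = (LINT x|lebesgue. f x * deriv \<phi> x - e * (f x * deriv \<eta> x))" using ints by simp
    also have "\<dots> = (LINT x|lebesgue. f x * (deriv ^^ 2) \<psi> x)"
      unfolding dd by (intro Bochner_Integration.integral_cong) (auto simp: algebra_simps)
    also have "\<dots> = 0" using orth[of \<psi>] \<psi>(1) by (simp add: numeral_2_eq_2)
    finally have 1: "(LINT x|lebesgue. f x * deriv \<phi> x) = e * (LINT x|lebesgue. f x * deriv \<eta> x)" by simp
    have 2: "(LINT x|lebesgue. x * deriv \<phi> x) = - (LINT x|lebesgue. \<phi> x)"
      using wid \<phi> unfolding has_weak_derivative_def by simp
    have "(LINT x|lebesgue. (f x - d * x) * deriv \<phi> x)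
        = (LINT x|lebesgue. f x * deriv \<phi> x) - d * (LINT x|lebesgue. x * deriv \<phi> x)"
      using ints by (simp add: left_diff_distrib mult.assoc)
    also have "\<dots> = 0" unfolding 1 2 by (simp add: d_def e_def)
    finally show "(LINT x|lebesgue. (f x - d * x) * deriv \<phi> x) = 0" .
  qed
  then obtain c where "negligible {x. f x - d * x \<noteq> c}" by blast
  moreover have "{x. f x - d * x \<noteq> c} = {x. f x \<noteq> c + d * x}" by auto
  ultimately show ?thesis by auto
qed

section \<open>The weak equation in integrated form\<close>

lemma L1_loc_step_data: "L1_loc (step_data Um Up)"
proof (rule L1_locI, rule measurable_bounded_by_integrable_imp_absolutely_integrable)
  fix R :: real
  have "step_data Um Up \<in> borel_measurable borel" unfolding step_data_def by measurable
  then show "step_data Um Up \<in> borel_measurable (lebesgue_on {-R..R})"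
    by (simp add: measurable_completion measurable_restrict_space1)
  show "(\<lambda>_. \<bar>Um\<bar> + \<bar>Up\<bar>) integrable_on {-R..R}" by (rule integrable_const_ivl)
qed (auto simp: step_data_def)

lemma step_data_int: "indefinite_integral_on UNIV (step_data Um Up) (\<lambda>y. y * step_data Um Up y)"
  unfolding indefinite_integral_on_def
proof (intro ballI impI conjI)
  fix s t :: real assume "s \<le> t"
  have cont: "continuous_on {s..t} (\<lambda>y. Um * min 0 y + Up * max 0 y)" by (intro continuous_intros)
  have eq: "(\<lambda>y. y * step_data Um Up y) = (\<lambda>y. Um * min 0 y + Up * max 0 y)"
    by (auto simp: fun_eq_iff step_data_def)
  have "(step_data Um Up has_integral
      (Um * min 0 t + Up * max 0 t) - (Um * min 0 s + Up * max 0 s)) {s..t}"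
  proof (rule fundamental_theorem_of_calculus_strong[where S="{0}", OF _ \<open>s \<le> t\<close> _ cont])
    fix x assume "x \<in> {s..t} - {0}"
    then consider "x < 0" | "0 < x" by fastforce
    then have "((\<lambda>y. Um * min 0 y + Up * max 0 y) has_real_derivative step_data Um Up x) (at x)"
    proof cases
      case 1
      have "((\<lambda>y. Um * y) has_real_derivative step_data Um Up x) (at x)"
        using 1 by (auto intro!: derivative_eq_intros simp: step_data_def)
      then show ?thesis
        by (rule has_field_derivative_transform_within_open[of _ _ _ "{..<0}"]) (use 1 in auto)
    next
      case 2
      have "((\<lambda>y. Up * y) has_real_derivative step_data Um Up x) (at x)"
        using 2 by (auto intro!: derivative_eq_intros simp: step_data_def)
      then show ?thesis
        by (rule has_field_derivative_transform_within_open[of _ _ _ "{0<..}"]) (use 2 in auto)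
    qed
    then show "((\<lambda>y. Um * min 0 y + Up * max 0 y) has_vector_derivative step_data Um Up x) (at x)"
      by (simp add: has_real_derivative_iff_has_vector_derivative)
  qed simp
  then show "(step_data Um Up has_integral t * step_data Um Up t - s * step_data Um Up s) {s..t}"
    using fun_cong[OF eq, of s] fun_cong[OF eq, of t] by simp
qed (rule L1_locD[OF L1_loc_step_data])

lemma LBINT_antiderivative:
  assumes "\<And>x. (F has_real_derivative f x) (at x)" "continuous_on UNIV f"
  shows "(LBINT s=ereal a..ereal b. f s) = F b - F a"
proof (rule interval_integral_FTC_finite)
  show "continuous_on {min a b..max a b} f" using assms(2) by (rule continuous_on_subset) simp
  show "(F has_vector_derivative f x) (at x within {min a b..max a b})" for x
    using assms(1)[of x] by (simp add: has_real_derivative_iff_has_vector_derivative has_vector_derivative_at_within)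
qed

lemma primitive_from_derivative:
  assumes "continuous_on UNIV E"
  shows "(primitive_from c E has_real_derivative E s) (at s)"
proof -
  obtain G where G: "indefinite_integral_on UNIV E G"
    using L1_loc_indefinite_integral[OF L1_loc_continuous[OF assms]] by blast
  have der: "(G has_real_derivative E x) (at x)" for x
    using assms by (intro indefinite_integral_on_derivative_at[OF G]) (simp add: continuous_on_eq_continuous_at)
  have "primitive_from c E = (\<lambda>u. G u - G c)"
    unfolding primitive_from_def by (rule ext, rule LBINT_antiderivative[OF der assms])
  then show ?thesis using DERIV_diff[OF der[of s] DERIV_const[of "G c"]] by simp
qed

text \<open>
  The replacement for limits at infinity: an integrable function need not tend to zero, but it is
  small somewhere in every sufficiently long interval.
\<close>

lemma small_values_if_integrable:
  fixes H :: "real \<Rightarrow> real"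
  assumes int: "H integrable_on UNIV" and nonneg: "\<And>x. 0 \<le> H x" and e: "0 < e"
  shows "\<exists>L>0. \<forall>T. \<exists>t\<in>{T..T+L}. H t < e"
proof -
  define I where "I = integral UNIV H"
  have I: "0 \<le> I" unfolding I_def by (rule integral_nonneg[OF int]) (simp add: nonneg)
  define L where "L = (I + 1) / e"
  have L: "0 < L" using I e by (simp add: L_def)
  have "\<exists>t\<in>{T..T+L}. H t < e" for T
  proof (rule ccontr)
    assume "\<not> (\<exists>t\<in>{T..T+L}. H t < e)"
    then have ge: "e \<le> H t" if "t \<in> {T..T+L}" for t using that by force
    have i: "H integrable_on {T..T+L}" by (rule integrable_on_subinterval[OF int]) simp
    have "e * L = integral {T..T+L} (\<lambda>_. e)" using L by (simp add: mult.commute)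
    also have "\<dots> \<le> integral {T..T+L} H" by (rule integral_le[OF integrable_const_ivl i ge])
    also have "\<dots> \<le> I" unfolding I_def by (rule integral_subset_le[OF _ i int]) (use nonneg in auto)
    finally show False using e by (simp add: L_def)
  qed
  then show ?thesis using L by blast
qed

text \<open>
  The function \<open>V\<close> is the continuous representative of \<open>v\<close>. With \<open>G' = u / 2\<close>, integration by parts
  turns the weak equation into orthogonality of \<open>A \<circ> u - \<integral> (G - y u / 2)\<close> to all second derivatives of
  test functions, so \<open>A \<circ> u\<close> is known up to an affine function; here \<open>G - y u / 2\<close> equals
  \<open>(V - y (u - step)) / 2\<close> for the choice \<open>G = (V + y step) / 2\<close>. The slope of the affine function
  vanishes since \<open>V\<close> and \<open>a - A (step)\<close> are square integrable: there are arbitrarily large points \<open>y\<close> where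
  both are small, and at these \<open>a\<close> is bounded, \<open>y V\<close> is small compared with \<open>y\<close>, and so is the integral
  of \<open>V\<close>.
\<close>

lemma weak_profile_equation:
  fixes E u v w :: "real \<Rightarrow> real" and Um Up :: real
  defines "A \<equiv> primitive_from Um E"
  assumes E_cont: "continuous_on UNIV E" and E_bdd: "bounded (range E)"
    and u_meas: "u \<in> borel_measurable lebesgue"
    and vw: "H1_derivative v w" and u: "AE y in lebesgue. u y = step_data Um Up y + w y"
    and weak: "\<And>\<psi>. Ck_c 2 \<psi> \<Longrightarrow> (LINT y|lebesgue. A (u y) * (deriv ^^ 2) \<psi> y
              - u y * deriv (\<lambda>t. t / 2 * \<psi> t) y) = 0"
  shows "\<exists>V a N. negligible N \<and> (\<forall>y. y \<notin> N \<longrightarrow> A (u y) = a y) \<and>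
     indefinite_integral_on UNIV (\<lambda>y. u y - step_data Um Up y) V \<and>
     indefinite_integral_on UNIV (\<lambda>y. (V y - y * (u y - step_data Um Up y)) / 2) a \<and>
     (\<forall>e>0. \<exists>L>0. \<forall>T. \<exists>t\<in>{T..T+L}. \<bar>V t\<bar> < e \<and> \<bar>a t - A (step_data Um Up t)\<bar> < e)"
proof -
  let ?st = "step_data Um Up"
  have A_der: "(A has_real_derivative E s) (at s)" for s
    unfolding A_def by (rule primitive_from_derivative[OF E_cont])
  have A_cont: "continuous_on UNIV A"
    using A_der DERIV_isCont by (intro continuous_at_imp_continuous_on) blast
  obtain C where C: "\<And>s. \<bar>E s\<bar> \<le> C" using E_bdd by (auto simp: bounded_real)
  have C0: "0 \<le> C" using C[of 0] by linarith
  have A_lip: "\<bar>A x - A y\<bar> \<le> C * \<bar>x - y\<bar>" for x y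
    using field_differentiable_bound[of UNIV A E C x y] A_der C by (auto intro: DERIV_subset)
  have wd: "has_weak_derivative v w" and L2: "L2 v" "L2 w" using vw by (auto simp: H1_derivative_def)
  have v1: "L1_loc v" and w1: "L1_loc w" using wd by (auto simp: has_weak_derivative_def)
  obtain Nu where Nu: "negligible Nu" "\<And>y. y \<notin> Nu \<Longrightarrow> u y = ?st y + w y"
    using u unfolding eventually_ae_filter_negligible by blast

  \<comment> \<open>a continuous representative of \<open>v\<close>\<close>
  obtain W where W: "indefinite_integral_on UNIV w W" using L1_loc_indefinite_integral[OF w1] by blast
  note W' = has_weak_derivative_indefinite_integral[OF W]
  have W1: "L1_loc W" using W' by (simp add: has_weak_derivative_def)
  have "\<exists>c. negligible {x. v x - W x \<noteq> c}"
  proof (rule du_Bois_Reymond)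
    show "L1_loc (\<lambda>x. v x - W x)" using v1 W1 by (auto simp: L1_loc_def intro: set_integral_diff(1))
    fix \<phi> assume \<phi>: "Ck_c 1 \<phi>"
    then have \<phi>': "Ck_c 0 (deriv \<phi>)" using Ck_c_SucD(2)[of 0] by simp
    show "(LINT x|lebesgue. (v x - W x) * deriv \<phi> x) = 0"
      using wd W' \<phi> integrable_mult_Ck_c[OF v1 \<phi>'] integrable_mult_Ck_c[OF W1 \<phi>']
      by (simp add: has_weak_derivative_def left_diff_distrib)
  qed
  then obtain c where c: "negligible {x. v x - W x \<noteq> c}" by blast
  define V where "V x = W x + c" for x
  have const: "indefinite_integral_on UNIV (\<lambda>_. 0) (\<lambda>_. c)" for c :: real by (simp add: indefinite_integral_on_def)
  have Vw: "indefinite_integral_on UNIV w V"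
    using indefinite_integral_on_add[OF W const[of c]] by (simp add: V_def[abs_def])
  have V: "indefinite_integral_on UNIV (\<lambda>y. u y - ?st y) V"
    by (rule indefinite_integral_on_cong[OF Vw _ Nu(1)]) (use Nu(2) in auto)
  define Nv where "Nv = {x. v x - W x \<noteq> c}"
  have Nv: "negligible Nv" "\<And>x. x \<notin> Nv \<Longrightarrow> v x = V x" using c by (auto simp: Nv_def V_def)
  have V_cont: "continuous_on UNIV V" by (rule indefinite_integral_on_UNIV_continuous[OF V])

  \<comment> \<open>the expected representative of \<open>A \<circ> u\<close>, up to an affine function\<close>
  obtain VV where VV: "indefinite_integral_on UNIV V VV" and VV0: "VV 0 = 0"
    using L1_loc_indefinite_integral[OF L1_loc_continuous[OF V_cont]] by blast
  define q where "q y = (V y - y * (u y - ?st y)) / 2" for y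
  have "indefinite_integral_on UNIV (\<lambda>y. V y * 1 + (u y - ?st y) * y) (\<lambda>y. V y * y)"
    by (rule indefinite_integral_on_mult[OF V]) (auto intro!: derivative_eq_intros)
  from indefinite_integral_on_diff[OF VV indefinite_integral_on_cmult[OF this, of "1/2"]]
  have P: "indefinite_integral_on UNIV q (\<lambda>y. VV y - 1/2 * (V y * y))"
    by (rule indefinite_integral_on_cong[where N="{}"]) (auto simp: q_def field_simps)
  note P' = has_weak_derivative_indefinite_integral[OF P]
  have q1: "L1_loc q" and P1: "L1_loc (\<lambda>y. VV y - 1/2 * (V y * y))"
    using P' by (auto simp: has_weak_derivative_def)
  have G: "indefinite_integral_on UNIV u (\<lambda>y. V y + y * ?st y)"
    using indefinite_integral_on_add[OF V step_data_int[of Um Up]] by simp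
  note G' = has_weak_derivative_indefinite_integral[OF G]
  have u1: "L1_loc u" and G1: "L1_loc (\<lambda>y. V y + y * ?st y)" using G' by (auto simp: has_weak_derivative_def)
  have Au1: "L1_loc (\<lambda>y. A (u y))"
  proof (rule L1_locI, rule measurable_bounded_by_integrable_imp_absolutely_integrable)
    fix R :: real
    show "(\<lambda>y. A (u y)) \<in> borel_measurable (lebesgue_on {-R..R})"
      by (intro measurable_restrict_space1 borel_measurable_continuous_on[OF A_cont u_meas])
    have "(\<lambda>y. \<bar>u y\<bar>) integrable_on {-R..R}"
      using L1_locD[OF u1] by (auto simp: absolutely_integrable_on_def)
    then show "(\<lambda>y. \<bar>A 0\<bar> + C * \<bar>u y\<bar>) integrable_on {-R..R}"
      by (intro integrable_add integrable_const_ivl integrable_on_mult_right)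
    show "norm (A (u y)) \<le> \<bar>A 0\<bar> + C * \<bar>u y\<bar>" for y using A_lip[of "u y" 0] by simp
  qed simp
  have "\<exists>c d. negligible {y. A (u y) - (VV y - 1/2 * (V y * y)) \<noteq> c + d * y}"
  proof (rule du_Bois_Reymond_second_order)
    show "L1_loc (\<lambda>y. A (u y) - (VV y - 1/2 * (V y * y)))"
      using Au1 P1 by (auto simp: L1_loc_def intro: set_integral_diff(1))
    fix \<psi> assume \<psi>: "Ck_c 2 \<psi>"
    then have \<psi>2: "Ck_c (Suc 1) \<psi>" by (simp add: numeral_2_eq_2)
    then have \<psi>1: "Ck_c 1 \<psi>" by (rule Ck_c_Suc_imp_Ck_c)
    have \<psi>': "Ck_c 1 (deriv \<psi>)" using Ck_c_SucD(2)[OF \<psi>2] .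
    then have \<psi>'0: "Ck_c 0 (deriv \<psi>)" using Ck_c_Suc_imp_Ck_c[of 0] by simp
    have \<psi>'': "Ck_c 0 ((deriv ^^ 2) \<psi>)" using Ck_c_SucD(2)[of 0 "deriv \<psi>"] \<psi>' by (simp add: numeral_2_eq_2)
    have dd: "deriv (deriv \<psi>) = (deriv ^^ 2) \<psi>" by (simp add: numeral_2_eq_2)
    have prod: "deriv (\<lambda>t. t / 2 * \<psi> t) y = \<psi> y / 2 + y / 2 * deriv \<psi> y" for y
      by (rule DERIV_imp_deriv) (auto intro!: derivative_eq_intros Ck_c_SucD(1)[OF \<psi>2])
    note i = integrable_mult_Ck_c[OF Au1 \<psi>''] integrable_mult_Ck_c[OF P1 \<psi>'']
      integrable_mult_Ck_c[OF u1 \<psi>1] integrable_mult_Ck_c[OF G1 \<psi>'0] integrable_mult_Ck_c[OF q1 \<psi>'0]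
    have "(LINT y|lebesgue. u y * deriv (\<lambda>t. t / 2 * \<psi> t) y)
        = (LINT y|lebesgue. 1/2 * (u y * \<psi> y) + (1/2 * ((V y + y * ?st y) * deriv \<psi> y) - q y * deriv \<psi> y))"
      unfolding prod by (intro Bochner_Integration.integral_cong) (auto simp: q_def field_simps)
    also have "\<dots> = 1/2 * (LINT y|lebesgue. u y * \<psi> y) +
        (1/2 * (LINT y|lebesgue. (V y + y * ?st y) * deriv \<psi> y) - (LINT y|lebesgue. q y * deriv \<psi> y))"
      using i by (simp add: integrable_diff)
    also have "\<dots> = - (LINT y|lebesgue. q y * deriv \<psi> y)"
      using G' \<psi>1 by (simp add: has_weak_derivative_def)
    also have "\<dots> = (LINT y|lebesgue. (VV y - 1/2 * (V y * y)) * (deriv ^^ 2) \<psi> y)"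
      using P' \<psi>' unfolding has_weak_derivative_def dd[symmetric] by simp
    finally have 1: "(LINT y|lebesgue. u y * deriv (\<lambda>t. t / 2 * \<psi> t) y)
        = (LINT y|lebesgue. (VV y - 1/2 * (V y * y)) * (deriv ^^ 2) \<psi> y)" .
    have i6: "integrable lebesgue (\<lambda>y. u y * deriv (\<lambda>t. t / 2 * \<psi> t) y)"
    proof -
      have "integrable lebesgue (\<lambda>y. 1/2 * (u y * \<psi> y) + (1/2 * ((V y + y * ?st y) * deriv \<psi> y) - q y * deriv \<psi> y))"
        using i by (intro Bochner_Integration.integrable_add Bochner_Integration.integrable_diff
            integrable_mult_right) auto
      moreover have "(\<lambda>y. 1/2 * (u y * \<psi> y) + (1/2 * ((V y + y * ?st y) * deriv \<psi> y) - q y * deriv \<psi> y))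
          = (\<lambda>y. u y * deriv (\<lambda>t. t / 2 * \<psi> t) y)"
        unfolding prod by (auto simp: q_def field_simps fun_eq_iff)
      ultimately show ?thesis by simp
    qed
    have "(LINT y|lebesgue. (A (u y) - (VV y - 1/2 * (V y * y))) * (deriv ^^ 2) \<psi> y)
        = (LINT y|lebesgue. A (u y) * (deriv ^^ 2) \<psi> y) - (LINT y|lebesgue. (VV y - 1/2 * (V y * y)) * (deriv ^^ 2) \<psi> y)"
      unfolding left_diff_distrib[of "A _"] by (rule Bochner_Integration.integral_diff[OF i(1,2)])
    also have "\<dots> = (LINT y|lebesgue. A (u y) * (deriv ^^ 2) \<psi> y - u y * deriv (\<lambda>t. t / 2 * \<psi> t) y)"
      unfolding 1[symmetric] by (rule Bochner_Integration.integral_diff[OF i(1) i6, symmetric])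
    also have "\<dots> = 0" by (rule weak[OF \<psi>])
    finally show "(LINT y|lebesgue. (A (u y) - (VV y - 1/2 * (V y * y))) * (deriv ^^ 2) \<psi> y) = 0" .
  qed
  then obtain k d where kd: "negligible {y. A (u y) - (VV y - 1/2 * (V y * y)) \<noteq> k + d * y}" by blast
  define a where "a y = k + d * y + (VV y - 1/2 * (V y * y))" for y
  define Na where "Na = {y. A (u y) \<noteq> a y}"
  have Na: "negligible Na" using kd by (rule negligible_subset) (auto simp: Na_def a_def)

  \<comment> \<open>square integrability makes \<open>V\<close> and \<open>a - A(step)\<close> small somewhere in every long interval\<close>
  define H where "H t = (V t)\<^sup>2 + (a t - A (?st t))\<^sup>2" for t
  have H_int: "H integrable_on UNIV"
  proof (rule measurable_bounded_by_integrable_imp_integrable)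
    have st_meas: "?st \<in> borel_measurable borel" unfolding step_data_def by measurable
    have A_meas: "A \<in> borel_measurable borel" by (rule borel_measurable_continuous_onI[OF A_cont])
    have V_meas: "V \<in> borel_measurable borel" by (rule borel_measurable_continuous_onI[OF V_cont])
    have VV_meas: "VV \<in> borel_measurable borel"
      by (rule borel_measurable_continuous_onI[OF indefinite_integral_on_UNIV_continuous[OF VV]])
    note [measurable] = st_meas A_meas V_meas VV_meas
    have "H \<in> borel_measurable borel" unfolding H_def a_def by measurable
    then show "H \<in> borel_measurable (lebesgue_on UNIV)"
      by (simp add: measurable_completion measurable_restrict_space1)
    have "integrable lebesgue (\<lambda>x. (v x)\<^sup>2 + C\<^sup>2 * (w x)\<^sup>2)" using L2 by (auto simp: L2_def)
    then have int: "(\<lambda>x. (v x)\<^sup>2 + C\<^sup>2 * (w x)\<^sup>2) integrable_on UNIV" by (rule integrable_on_lebesgue)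
    define F where "F x = (if x \<in> Nu \<union> Nv \<union> Na then H x else (v x)\<^sup>2 + C\<^sup>2 * (w x)\<^sup>2)" for x
    show "F integrable_on UNIV"
      by (rule integrable_spike[OF int, of "Nu \<union> Nv \<union> Na"]) (use Nu Nv Na in \<open>auto simp: F_def\<close>)
    show "norm (H x) \<le> F x" for x
    proof (cases "x \<in> Nu \<union> Nv \<union> Na")
      case False
      have "\<bar>a x - A (?st x)\<bar> \<le> C * \<bar>w x\<bar>"
        using A_lip[of "u x" "?st x"] Nu(2)[of x] False by (simp add: Na_def)
      then have "\<bar>a x - A (?st x)\<bar>\<^sup>2 \<le> (C * \<bar>w x\<bar>)\<^sup>2" by (intro power_mono) auto
      then show ?thesis using False Nv(2)[of x] by (simp add: F_def H_def power_mult_distrib)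
    qed (simp add: F_def H_def)
  qed simp
  have small: "\<exists>L>0. \<forall>T. \<exists>t\<in>{T..T+L}. \<bar>V t\<bar> < e \<and> \<bar>a t - A (?st t)\<bar> < e" if e: "0 < e" for e
  proof -
    obtain L where L: "0 < L" "\<And>T. \<exists>t\<in>{T..T+L}. H t < e\<^sup>2"
      using small_values_if_integrable[OF H_int, of "e\<^sup>2"] e by (auto simp: H_def)
    have "\<bar>V t\<bar> < e \<and> \<bar>a t - A (?st t)\<bar> < e" if "H t < e\<^sup>2" for t
    proof -
      have "\<bar>V t\<bar>\<^sup>2 < e\<^sup>2" "\<bar>a t - A (?st t)\<bar>\<^sup>2 < e\<^sup>2"
        using that zero_le_power2[of "V t"] zero_le_power2[of "a t - A (?st t)"] unfolding H_def power2_abs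
        by linarith+
      then show ?thesis using e by (blast intro: power_less_imp_less_base less_imp_le)
    qed
    then show ?thesis using L by meson
  qed

  \<comment> \<open>hence the affine part has slope zero\<close>
  have "d = 0"
  proof (rule ccontr)
    assume "d \<noteq> 0"
    \<comment> \<open>with this choice the remaining terms amount to at most \<open>3/8 * \<bar>d\<bar> * t\<close> plus a constant\<close>
    define \<eta> where "\<eta> = \<bar>d\<bar> / 4"
    have \<eta>: "0 < \<eta>" using \<open>d \<noteq> 0\<close> by (simp add: \<eta>_def)
    have V2: "(\<lambda>x. (V x)\<^sup>2) integrable_on UNIV"
    proof (rule integrable_spike[OF integrable_on_lebesgue _ ])
      show "integrable lebesgue (\<lambda>x. (v x)\<^sup>2)" using L2 by (simp add: L2_def)
    qed (use Nv in auto)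
    define I where "I = integral UNIV (\<lambda>x. (V x)\<^sup>2)"
    have VV_bound: "\<bar>VV t\<bar> \<le> \<eta> * t + I / \<eta>" if "0 \<le> t" for t
    proof -
      have sq: "(\<lambda>x. (V x)\<^sup>2) integrable_on {0..t}" by (rule integrable_on_subinterval[OF V2]) simp
      have "\<bar>VV t\<bar> = norm (integral {0..t} V)"
        using indefinite_integral_onD(4)[OF VV, of 0 t] that VV0 by simp
      also have "\<dots> \<le> integral {0..t} (\<lambda>x. \<eta> + (V x)\<^sup>2 / \<eta>)"
      proof (rule integral_norm_bound_integral)
        show "V integrable_on {0..t}" using indefinite_integral_onD(3)[OF VV, of 0 t] that by simp
        show "(\<lambda>x. \<eta> + (V x)\<^sup>2 / \<eta>) integrable_on {0..t}"
          by (intro integrable_add integrable_const_ivl integrable_on_divide sq)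
        show "norm (V x) \<le> \<eta> + (V x)\<^sup>2 / \<eta>" for x
        proof (cases "\<bar>V x\<bar> \<le> \<eta>")
          case True
          have "0 \<le> (V x)\<^sup>2 / \<eta>" using \<eta> by simp
          then show ?thesis using True unfolding real_norm_def by linarith
        next
          case False
          then have "\<eta> * \<bar>V x\<bar> \<le> \<bar>V x\<bar> * \<bar>V x\<bar>" by (intro mult_right_mono) auto
          then have "\<bar>V x\<bar> \<le> (V x)\<^sup>2 / \<eta>" using \<eta> by (simp add: field_simps power2_eq_square)
          then show ?thesis using \<eta> unfolding real_norm_def by linarith
        qed
      qed
      also have "\<dots> = \<eta> * t + integral {0..t} (\<lambda>x. (V x)\<^sup>2) / \<eta>"
        using sq that by (simp add: Henstock_Kurzweil_Integration.integral_add integrable_const_ivl integrable_on_divide)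
      also have "\<dots> \<le> \<eta> * t + I / \<eta>"
        unfolding I_def using \<eta> by (intro add_left_mono divide_right_mono integral_subset_le[OF _ sq V2]) auto
      finally show ?thesis .
    qed
    define K where "K = \<bar>A Up\<bar> + \<eta> + \<bar>k\<bar> + I / \<eta>"
    define T where "T = max 0 (2 * K / \<bar>d\<bar> + 1)"
    obtain t where t: "T \<le> t" "\<bar>V t\<bar> < \<eta>" "\<bar>a t - A (?st t)\<bar> < \<eta>"
      using small[OF \<eta>] by (metis atLeastAtMost_iff)
    have t0: "0 \<le> t" using t(1) by (simp add: T_def)
    then have "?st t = Up" by (simp add: step_data_def)
    then have "\<bar>a t - A Up\<bar> < \<eta>" using t(3) by simp
    then have at: "\<bar>a t\<bar> \<le> \<bar>A Up\<bar> + \<eta>" by linarith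
    have "\<bar>V t * t\<bar> \<le> \<eta> * t" using t(2) t0 by (simp add: abs_mult mult_right_mono)
    moreover have "d * t = a t - k - VV t + 1/2 * (V t * t)" by (simp add: a_def)
    ultimately have "\<bar>d * t\<bar> \<le> K + \<eta> * t + \<eta> * t / 2"
      using at VV_bound[OF t0] unfolding K_def by linarith
    then have "\<bar>d\<bar> * t \<le> K + 3/8 * (\<bar>d\<bar> * t)" using t0 by (simp add: abs_mult \<eta>_def mult.commute[of t])
    moreover have "2 * K + \<bar>d\<bar> \<le> \<bar>d\<bar> * t"
    proof -
      have "\<bar>d\<bar> * (2 * K / \<bar>d\<bar> + 1) \<le> \<bar>d\<bar> * t" using t(1) by (intro mult_left_mono) (auto simp: T_def)
      moreover have "\<bar>d\<bar> * (2 * K / \<bar>d\<bar> + 1) = 2 * K + \<bar>d\<bar>"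
        using \<open>d \<noteq> 0\<close> by (simp add: distrib_left)
      ultimately show ?thesis by simp
    qed
    moreover have "0 < \<bar>d\<bar>" "0 \<le> \<bar>d\<bar> * t" using \<open>d \<noteq> 0\<close> t0 by auto
    moreover have "0 \<le> K"
      unfolding K_def I_def using \<eta> integral_nonneg[OF V2] by simp
    ultimately show False using \<open>d \<noteq> 0\<close> by linarith
  qed
  then have a_int: "indefinite_integral_on UNIV q a"
    using indefinite_integral_on_add[OF const[of k] P] by (simp add: a_def[abs_def])
  show ?thesis
  proof (intro exI conjI)
    show "negligible Na" by (rule Na)
    show "\<forall>y. y \<notin> Na \<longrightarrow> A (u y) = a y" by (simp add: Na_def)
    show "indefinite_integral_on UNIV (\<lambda>y. u y - ?st y) V" by (rule V)
    show "indefinite_integral_on UNIV (\<lambda>y. (V y - y * (u y - ?st y)) / 2) a"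
      using a_int by (simp add: q_def[abs_def])
    show "\<forall>e>0. \<exists>L>0. \<forall>T. \<exists>t\<in>{T..T+L}. \<bar>V t\<bar> < e \<and> \<bar>a t - A (?st t)\<bar> < e" using small by blast
  qed
qed

section \<open>Solutions of the integrated equation on a half line\<close>

text \<open>
  The integrated equation for \<open>y > 0\<close>, with \<open>P\<close> the limit at infinity. The assumptions at infinity only
  ask for small values at some arbitrarily large points; monotonicity upgrades them later.
\<close>

locale weak_half_line =
  fixes A u a v :: "real \<Rightarrow> real" and P :: real and N :: "real set"
  assumes A_mono: "mono A" and A_cont: "continuous_on UNIV A"
    and N: "negligible N"
    and A_u: "\<And>y. 0 < y \<Longrightarrow> y \<notin> N \<Longrightarrow> A (u y) = a y"
    and v_int: "indefinite_integral_on {0..} (\<lambda>y. u y - P) v"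
    and a_int: "indefinite_integral_on {0..} (\<lambda>y. (v y - y * (u y - P)) / 2) a"
    and v_small: "\<And>T e. 0 < e \<Longrightarrow> \<exists>t>T. \<bar>v t\<bar> < e"
    and a_small: "\<And>T e. 0 < e \<Longrightarrow> \<exists>t>T. \<bar>a t - A P\<bar> < e"
begin

text \<open>
  Changing the sign of all unknowns reduces statements about falling solutions to rising ones.
\<close>

lemma negated: "weak_half_line (\<lambda>s. - A (- s)) (\<lambda>y. - u y) (\<lambda>y. - a y) (\<lambda>y. - v y) (- P) N"
proof
  show "mono (\<lambda>s. - A (- s))" using A_mono by (auto simp: mono_def)
  show "continuous_on UNIV (\<lambda>s. - A (- s))"
    by (intro continuous_intros continuous_on_compose2[OF A_cont]) auto
  show "indefinite_integral_on {0..} (\<lambda>y. - u y - - P) (\<lambda>y. - v y)"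
    using indefinite_integral_on_cmult[OF v_int, of "-1"] by simp
  show "indefinite_integral_on {0..} (\<lambda>y. (- v y - y * (- u y - - P)) / 2) (\<lambda>y. - a y)"
    by (rule indefinite_integral_on_cong[OF indefinite_integral_on_cmult[OF a_int, of "-1"], where N="{}"])
      (auto simp: field_simps)
  show "\<exists>t>T. \<bar>- a t - (- A (- (- P)))\<bar> < e" if "0 < e" for T e
    using a_small[OF that, of T] by (auto simp: abs_minus_commute)
qed (use A_u N v_small in auto)

text \<open>
  The state at which the flux would vanish: in terms of it the equations read \<open>y * m' = u - m\<close> and
  \<open>a' = y * (m - u) / 2\<close>.
\<close>

definition m where "m y = P + v y / y"
definition d where "d y = A (m y) - a y"

lemma v_eq: "0 < y \<Longrightarrow> v y = y * (m y - P)" by (simp add: m_def)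

lemma v_cont: "continuous_on {0..} v"
  by (rule continuous_on_atLeast_if_Icc, rule indefinite_integral_on_continuous,
      rule indefinite_integral_on_subset[OF v_int]) auto

lemma a_cont: "continuous_on {0..} a"
  by (rule continuous_on_atLeast_if_Icc, rule indefinite_integral_on_continuous,
      rule indefinite_integral_on_subset[OF a_int]) auto

lemma m_cont: "continuous_on {0<..} m"
  unfolding m_def by (intro continuous_intros continuous_on_subset[OF v_cont]) auto

lemma d_cont: "continuous_on {0<..} d"
  unfolding d_def
  by (intro continuous_intros continuous_on_compose2[OF A_cont m_cont] continuous_on_subset[OF a_cont]) auto

lemma m_max:
  assumes "0 < s" "s \<le> t"
  obtains r where "s \<le> r" "r \<le> t" "\<And>y. s \<le> y \<Longrightarrow> y \<le> t \<Longrightarrow> m y \<le> m r"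
proof -
  have "continuous_on {s..t} m" by (rule continuous_on_subset[OF m_cont]) (use assms in auto)
  then have "\<exists>r\<in>{s..t}. \<forall>y\<in>{s..t}. m y \<le> m r"
    by (intro continuous_attains_sup) (use assms in auto)
  then show thesis using that by auto
qed

text \<open>
  If \<open>m\<close> attains its maximum over \<open>{s..t}\<close> at \<open>r\<close>, then \<open>u \<le> m r\<close> almost everywhere on \<open>{s..r}\<close>, so the increment of \<open>v\<close>
  there is at most that of \<open>(m r - P) * y\<close>, which equals \<open>v\<close> at \<open>r\<close>. Hence \<open>m r \<le> m s\<close>. No differentiation
  of \<open>m\<close> is involved.
\<close>

lemma m_antimono:
  assumes "0 < s" "s \<le> t" and "negligible N'"
    and le: "\<And>y. s \<le> y \<Longrightarrow> y \<le> t \<Longrightarrow> y \<notin> N' \<Longrightarrow> u y \<le> m y"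
  shows "m t \<le> m s"
proof -
  obtain r where r: "s \<le> r" "r \<le> t" and max: "\<And>y. s \<le> y \<Longrightarrow> y \<le> t \<Longrightarrow> m y \<le> m r"
    using m_max[OF assms(1,2)] by blast
  have lin: "indefinite_integral_on {0..} (\<lambda>_. m r - P) (\<lambda>y. (m r - P) * y)"
    by (rule indefinite_integral_on_derivative)
      (auto intro!: derivative_eq_intros simp: is_interval_ci)
  have "v r - v s \<le> (m r - P) * r - (m r - P) * s"
  proof (rule indefinite_integral_on_mono[OF v_int lin assms(3)])
    fix y assume "s \<le> y" "y \<le> r" "y \<notin> N'"
    then show "u y - P \<le> m r - P" using le[of y] max[of y] r by simp
  qed (use assms r in auto)
  then have "s * (m r - P) \<le> s * (m s - P)"
    using v_eq[of r] v_eq[of s] assms(1) r by (simp add: algebra_simps)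
  then have "m r \<le> m s" using assms(1) by simp
  then show ?thesis using max[of t] assms(2) by simp
qed

lemma u_less_m: "0 < y \<Longrightarrow> y \<notin> N \<Longrightarrow> 0 < d y \<Longrightarrow> u y < m y"
  using A_u[of y] monoD[OF A_mono, of "m y" "u y"] by (cases "m y \<le> u y") (auto simp: d_def)

lemma a_strict_mono:
  assumes "0 < s" "s < t" and pos: "\<And>y. s \<le> y \<Longrightarrow> y \<le> t \<Longrightarrow> 0 < d y"
  shows "a s < a t"
proof (rule indefinite_integral_on_strict_mono[OF a_int N])
  fix y assume y: "s \<le> y" "y \<le> t" "y \<notin> N"
  have "y * (u y - P) < y * (m y - P)" using u_less_m[of y] y assms by simp
  then show "0 < (v y - y * (u y - P)) / 2" using v_eq[of y] y assms by simp
qed (use assms in auto)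

lemma d_decreasing:
  assumes "0 < s" "s < t" and pos: "\<And>y. s \<le> y \<Longrightarrow> y \<le> t \<Longrightarrow> 0 < d y"
  shows "d t < d s"
proof -
  have "m t \<le> m s"
    using assms u_less_m by (intro m_antimono[OF _ _ N]) (auto intro!: less_imp_le)
  then have "A (m t) \<le> A (m s)" using A_mono by (simp add: mono_def)
  then show ?thesis using a_strict_mono[OF assms] by (simp add: d_def)
qed

text \<open>
  Where \<open>d\<close> is positive it strictly decreases, so going to the left it cannot come down to half of its value.
\<close>

lemma d_pos_left:
  assumes "0 < s" "s \<le> t" "0 < d t"
  shows "0 < d s"
proof (rule ccontr)
  assume "\<not> 0 < d s"
  then have ds: "d s \<le> 0" by simp
  have cont: "continuous_on {x..t} d" if "s \<le> x" for x
    by (rule continuous_on_subset[OF d_cont]) (use assms that in auto)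
  have "compact {x \<in> {s..t}. d x \<le> d t / 2}"
    unfolding compact_eq_bounded_closed
    by (intro conjI continuous_on_closed_Collect_le cont continuous_intros
        bounded_subset[OF bounded_closed_interval[of s t]]) auto
  moreover have "s \<in> {x \<in> {s..t}. d x \<le> d t / 2}" using ds assms by auto
  ultimately obtain r where r: "s \<le> r" "r \<le> t" "d r \<le> d t / 2"
    and r_max: "\<And>x. s \<le> x \<Longrightarrow> x \<le> t \<Longrightarrow> d x \<le> d t / 2 \<Longrightarrow> x \<le> r"
    using compact_attains_sup[of "{x \<in> {s..t}. d x \<le> d t / 2}"] by auto
  have "r < t" using r assms by (cases "r = t") auto
  obtain x where x: "r \<le> x" "x \<le> t" "d x = d t / 2"
    using IVT'[of d r "d t / 2" t] cont[of r] r assms by auto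
  then have "x = r" using r_max[of x] r by auto
  then have dr: "d r = d t / 2" using x by simp
  have "d t < d r"
  proof (rule d_decreasing)
    fix y assume y: "r \<le> y" "y \<le> t"
    show "0 < d y"
    proof (cases "y = r")
      case False
      then show ?thesis using r_max[of y] y r assms by force
    qed (use dr assms in simp)
  qed (use \<open>r < t\<close> r assms in auto)
  then show False using dr assms by simp
qed

lemma m_negated: "weak_half_line.m (\<lambda>y. - v y) (- P) = (\<lambda>y. - m y)"
  by (auto simp: weak_half_line.m_def[OF negated] m_def)

lemma d_negated: "weak_half_line.d (\<lambda>s. - A (- s)) (\<lambda>y. - a y) (\<lambda>y. - v y) (- P) = (\<lambda>y. - d y)"
  by (auto simp: weak_half_line.d_def[OF negated] m_negated d_def)

lemma d_neg_left: "0 < s \<Longrightarrow> s \<le> t \<Longrightarrow> d t < 0 \<Longrightarrow> d s < 0"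
  using weak_half_line.d_pos_left[OF negated, of s t] by (simp add: d_negated)

text \<open>
  Here \<open>a = A \<circ> m\<close>, so formally \<open>A'(m) m' = - (y\<^sup>2 / 2) m'\<close> with \<open>A' \<ge> 0\<close> and \<open>m\<close> is constant. To avoid
  differentiating, the argument compares with the maximum of \<open>m\<close>, using that \<open>a + y * v / 2\<close> is a
  primitive of \<open>v\<close>. Together with the negated system this gives constancy.
\<close>

lemma m_le_if_d_zero:
  assumes "0 < s" "s \<le> t" and zero: "\<And>y. s \<le> y \<Longrightarrow> y \<le> t \<Longrightarrow> d y = 0"
  shows "m t \<le> m s"
proof -
  obtain r where r: "s \<le> r" "r \<le> t" and max: "\<And>y. s \<le> y \<Longrightarrow> y \<le> t \<Longrightarrow> m y \<le> m r"
    using m_max[OF assms(1,2)] by blast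
  have sub: "{s..r} \<subseteq> {0..}" using assms r by auto
  note v' = indefinite_integral_on_subset[OF v_int sub]
    and a' = indefinite_integral_on_subset[OF a_int sub]
  have "indefinite_integral_on {s..r} (\<lambda>y. v y * 1 + (u y - P) * y) (\<lambda>y. v y * y)"
    by (rule indefinite_integral_on_mult[OF v']) (auto intro!: derivative_eq_intros)
  from indefinite_integral_on_add[OF a' indefinite_integral_on_cmult[OF this, of "1/2"]]
  have sum: "indefinite_integral_on {s..r} v (\<lambda>y. a y + 1/2 * (v y * y))"
    by (rule indefinite_integral_on_cong[where N="{}"]) (auto simp: field_simps is_interval_cc)
  have quad: "indefinite_integral_on {s..r} (\<lambda>y. (m r - P) * y) (\<lambda>y. (m r - P) * y\<^sup>2 / 2)"
    by (rule indefinite_integral_on_derivative)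
      (auto intro!: derivative_eq_intros continuous_intros simp: is_interval_cc)
  have "(a r + 1/2 * (v r * r)) - (a s + 1/2 * (v s * s))
      \<le> (m r - P) * r\<^sup>2 / 2 - (m r - P) * s\<^sup>2 / 2"
  proof (rule indefinite_integral_on_mono[OF sum quad negligible_empty])
    fix y assume "s \<le> y" "y \<le> r"
    then show "v y \<le> (m r - P) * y"
      using max[of y] v_eq[of y] r assms by (simp add: mult.commute)
  qed (use r in auto)
  then have "a r - a s \<le> s\<^sup>2 * (m s - m r) / 2"
    using v_eq[of r] v_eq[of s] r assms by (simp add: field_simps power2_eq_square)
  moreover have "a s \<le> a r"
    using zero[of r] zero[of s] monoD[OF A_mono max[of s]] r assms by (simp add: d_def)
  ultimately have "0 \<le> s\<^sup>2 * (m s - m r)" by simp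
  then have "m r \<le> m s" using assms(1) by (simp add: zero_le_mult_iff)
  then show ?thesis using max[of t] assms by simp
qed

lemma constant_if_d_zero:
  assumes "0 < z" and zero: "\<And>y. z \<le> y \<Longrightarrow> d y = 0"
  shows "\<And>y. z \<le> y \<Longrightarrow> m y = P" and "negligible {y. z \<le> y \<and> u y \<noteq> P}"
proof -
  have const: "m y = m z" if "z \<le> y" for y
  proof (rule antisym)
    show "m y \<le> m z" by (rule m_le_if_d_zero[OF assms(1) that zero])
    have "- m y \<le> - m z"
      by (rule weak_half_line.m_le_if_d_zero[OF negated, unfolded d_negated m_negated, OF assms(1) that])
        (simp add: zero)
    then show "m z \<le> m y" by simp
  qed
  have "m z = P"
  proof (rule ccontr)
    assume "m z \<noteq> P"
    then have "0 < \<bar>m z - P\<bar>" by simp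
    from v_small[OF this] obtain t where t: "t > max z 1" "\<bar>v t\<bar> < \<bar>m z - P\<bar>" by blast
    have "1 * \<bar>m z - P\<bar> \<le> t * \<bar>m z - P\<bar>" using t(1) by (intro mult_right_mono) auto
    also have "\<dots> = \<bar>v t\<bar>" using t(1) v_eq[of t] const[of t] assms(1) by (simp add: abs_mult)
    finally show False using t(2) by simp
  qed
  then show m_P: "m y = P" if "z \<le> y" for y using const[OF that] by simp
  have "negligible {y. z \<le> y \<and> u y - P \<noteq> 0}"
  proof (rule has_integral_zero_imp_AE_zero_atLeast)
    fix s t assume st: "z \<le> s" "s \<le> t"
    have v0: "v y = 0" if "z \<le> y" for y using v_eq[of y] m_P[OF that] that assms(1) by simp
    have "((\<lambda>y. u y - P) has_integral v t - v s) {s..t}"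
      by (rule indefinite_integral_onD(2)[OF v_int]) (use st assms(1) in auto)
    then show "((\<lambda>y. u y - P) has_integral 0) {s..t}"
      using v0[of s] v0[of t] st by simp
  qed
  then show "negligible {y. z \<le> y \<and> u y \<noteq> P}" by simp
qed

text \<open>
  The gap \<open>d\<close> is nonnegative everywhere and positive exactly to the left of a closed ray \<open>Z\<close>, possibly
  empty, on which \<open>u = P\<close> almost everywhere. To the left of \<open>Z\<close> the function \<open>a\<close> is strictly increasing, and a strict
  inequality between values of \<open>A\<close> forces one between their arguments; this is why flat pieces of \<open>A\<close>
  do no harm.
\<close>

lemma increasing_case:
  assumes t0: "0 < t0" "0 < d t0"
  shows "\<exists>N'. negligible N' \<and> 0 < v 0 \<and> (\<forall>y\<ge>0. 0 \<le> v y) \<and>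
      (\<forall>y>0. y \<notin> N' \<longrightarrow> u y \<le> P \<and> A (u y) = a y) \<and>
      (\<forall>x y. 0 < x \<longrightarrow> x < y \<longrightarrow> x \<notin> N' \<longrightarrow> y \<notin> N' \<longrightarrow> u x \<le> u y) \<and>
      (\<forall>t>0. a 0 < a t) \<and> a 0 < A P"
proof -
  have d_nonneg: "0 \<le> d y" if "0 < y" for y
  proof (cases "y \<le> t0")
    case True
    then show ?thesis using d_pos_left[of y t0] that t0 by simp
  next
    case False
    then show ?thesis using d_neg_left[of t0 y] t0 by (cases "d y < 0") auto
  qed
  define Z where "Z = {y. 0 < y \<and> d y = 0}"
  have Z_up: "y \<in> Z" if "z \<in> Z" "z \<le> y" for y z
  proof -
    have "0 < z" "d z = 0" "0 < y" using that by (auto simp: Z_def)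
    then show ?thesis using d_pos_left[of z y] d_nonneg[of y] that(2) by (cases "0 < d y") (auto simp: Z_def)
  qed
  have "\<exists>N'. negligible N' \<and> N \<subseteq> N' \<and> (\<forall>y\<in>Z - N'. u y = P) \<and> (\<forall>y\<in>Z. m y = P)"
  proof (cases "Z = {}")
    case False
    have Z_eq: "Z = {y \<in> {t0..}. d y \<le> 0}"
    proof -
      have "t0 \<le> y" if "0 < y" "d y = 0" for y
        using d_pos_left[of y t0] that t0 by (cases "y \<le> t0") auto
      moreover have "d y = 0" "0 < y" if "t0 \<le> y" "d y \<le> 0" for y
        using d_nonneg[of y] that t0 by auto
      ultimately show ?thesis unfolding Z_def by auto
    qed
    have "continuous_on {t0..} d" by (rule continuous_on_subset[OF d_cont]) (use t0 in auto)
    then have "closed Z" unfolding Z_eq by (intro continuous_on_closed_Collect_le) auto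
    then have "Inf Z \<in> Z" using False by (intro closed_contains_Inf) (auto simp: Z_eq)
    have Inf_le: "Inf Z \<le> y" if "y \<in> Z" for y using that by (intro cInf_lower) (auto simp: Z_eq)
    have z: "0 < Inf Z" "\<And>y. Inf Z \<le> y \<Longrightarrow> d y = 0"
      using \<open>Inf Z \<in> Z\<close> Z_up[OF \<open>Inf Z \<in> Z\<close>] by (auto simp: Z_def)
    show ?thesis
      using constant_if_d_zero[OF z] Inf_le N
      by (intro exI[of _ "N \<union> {y. Inf Z \<le> y \<and> u y \<noteq> P}"]) auto
  qed (use N in auto)
  then obtain N' where N': "negligible N'" "N \<subseteq> N'"
    and u_Z: "\<And>y. y \<in> Z \<Longrightarrow> y \<notin> N' \<Longrightarrow> u y = P" and m_Z: "\<And>y. y \<in> Z \<Longrightarrow> m y = P" by blast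
  have not_N: "y \<notin> N" if "y \<notin> N'" for y using that N'(2) by blast
  have u_m: "u y \<le> m y" if "0 < y" "y \<notin> N'" for y
    using u_less_m[of y] u_Z[of y] m_Z[of y] d_nonneg[of y] not_N[of y] that by (cases "d y = 0") (auto simp: Z_def less_imp_le)
  have m_anti: "m t \<le> m s" if "0 < s" "s \<le> t" for s t
    using that u_m by (intro m_antimono[OF _ _ N'(1)]) auto
  have m_P: "P \<le> m s" if "0 < s" for s
  proof (rule ccontr)
    assume "\<not> P \<le> m s"
    then have "0 < P - m s" by simp
    from v_small[OF this] obtain t where t: "t > max s 1" "\<bar>v t\<bar> < P - m s" by blast
    have "P - m s \<le> P - m t" using m_anti[of s t] t that by simp
    also have "\<dots> \<le> t * (P - m t)"
      using t(1) \<open>P - m s \<le> P - m t\<close> \<open>\<not> P \<le> m s\<close> mult_right_mono[of 1 t "P - m t"] by auto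
    finally show False using t v_eq[of t] that by (simp add: algebra_simps)
  qed
  have a_mono: "a s \<le> a t" if "0 \<le> s" "s \<le> t" for s t
  proof -
    have "0 - 0 \<le> a t - a s"
    proof (rule indefinite_integral_on_mono[OF _ a_int, where f="\<lambda>_. 0" and F="\<lambda>_. 0" and N="insert 0 N'"])
      fix y assume y: "s \<le> y" "y \<le> t" "y \<notin> insert 0 N'"
      then have "y * (u y - P) \<le> y * (m y - P)" using u_m[of y] that by (intro mult_left_mono) auto
      then show "0 \<le> (v y - y * (u y - P)) / 2" using v_eq[of y] y that by simp
    qed (use that N' in \<open>auto simp: indefinite_integral_on_def\<close>)
    then show ?thesis by simp
  qed
  have a_le: "a s \<le> A P" if "0 \<le> s" for s
  proof (rule ccontr)
    assume "\<not> a s \<le> A P"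
    then have "0 < a s - A P" by simp
    from a_small[OF this] obtain t where "t > s" "\<bar>a t - A P\<bar> < a s - A P" by blast
    then show False using a_mono[of s t] that by simp
  qed
  have strict: "a x < a y" if "0 < x" "x < y" "0 < d y" for x y
    using that d_pos_left[of _ y] by (intro a_strict_mono) auto
  have u_less_P: "u y < P" if y: "0 < y" "y \<notin> N'" "0 < d y" for y
  proof -
    have "isCont d y"
      using d_cont y(1) by (auto simp: continuous_on_eq_continuous_at)
    then have "\<forall>\<^sub>F x in at y. 0 < d x" using y(3) by (auto simp: isCont_def order_tendsto_iff)
    then obtain e where e: "0 < e" "\<And>x. x \<noteq> y \<Longrightarrow> dist x y < e \<Longrightarrow> 0 < d x"
      by (auto simp: eventually_at)
    have "0 < d (y + e/2)" using e by (intro e(2)) (auto simp: dist_real_def)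
    then have "a y < a (y + e/2)" using y e by (intro strict) auto
    also have "\<dots> \<le> A P" using y e by (intro a_le) auto
    finally have "A (u y) < A P" using A_u[of y] y not_N[of y] by simp
    then show ?thesis using A_mono by (meson linorder_not_le mono_def)
  qed
  have u_P: "u y \<le> P" if "0 < y" "y \<notin> N'" for y
    using u_less_P[of y] u_Z[of y] d_nonneg[of y] that by (cases "d y = 0") (auto simp: Z_def less_imp_le)
  have u_mono: "u x \<le> u y" if xy: "0 < x" "x < y" "x \<notin> N'" "y \<notin> N'" for x y
  proof (cases "0 < d y")
    case True
    then have "A (u x) < A (u y)" using strict[of x y] A_u[of x] A_u[of y] not_N[of x] not_N[of y] xy by simp
    then show ?thesis using A_mono by (meson linorder_not_le mono_def less_imp_le)
  next
    case False
    then have "u y = P" using xy d_nonneg[of y] by (intro u_Z) (auto simp: Z_def)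
    then show ?thesis using u_P xy by simp
  qed
  have a0: "a 0 < a t" if "0 < t" for t
  proof -
    define r where "r = min t t0"
    have "a 0 \<le> a (r/2)" using t0 that by (intro a_mono) (auto simp: r_def)
    also have "\<dots> < a r" using t0 that d_pos_left[of r t0] by (intro strict) (auto simp: r_def)
    also have "\<dots> \<le> a t" using t0 that by (intro a_mono) (auto simp: r_def)
    finally show ?thesis .
  qed
  have v_pos: "0 \<le> v y" if "0 < y" for y using m_P[OF that] v_eq[OF that] that by simp
  have "(\<lambda>y. - v y) 0 < (\<lambda>y. - v y) t0"
  proof (rule indefinite_integral_on_strict_mono[OF indefinite_integral_on_cmult[OF v_int, of "-1", simplified]])
    show "negligible (insert 0 N')" using N' by simp
    fix y assume "0 \<le> y" "y \<le> t0" "y \<notin> insert 0 N'"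
    then show "0 < P - u y" using u_less_P[of y] d_pos_left[of y t0] t0 by auto
  qed (use t0 in auto)
  then have v0: "0 < v 0" using v_pos[OF t0(1)] by simp
  show ?thesis
  proof (intro exI[of _ N'] conjI allI impI)
    show "0 \<le> v y" if "0 \<le> y" for y using that v0 v_pos[of y] by (cases "y = 0") auto
    show "u y \<le> P" "A (u y) = a y" if "0 < y" "y \<notin> N'" for y
      using u_P[OF that] A_u[OF that(1) not_N[OF that(2)]] by simp_all
    show "u x \<le> u y" if "0 < x" "x < y" "x \<notin> N'" "y \<notin> N'" for x y by (rule u_mono[OF that])
    show "a 0 < a t" if "0 < t" for t by (rule a0[OF that])
    show "a 0 < A P" using a0[OF t0(1)] a_le[of t0] t0 by simp
  qed (rule N'(1), rule v0)
qed

text \<open>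
  Either the negated system is increasing, or the gap vanishes identically and \<open>m = P\<close> throughout.
\<close>

lemma nonincreasing_case:
  assumes "\<And>t. 0 < t \<Longrightarrow> d t \<le> 0"
  shows "v 0 \<le> 0 \<and> A P \<le> a 0"
proof (cases "\<exists>t>0. d t < 0")
  case True
  then obtain t where "0 < t" "0 < - d t" by auto
  note inc = weak_half_line.increasing_case[OF negated, unfolded d_negated minus_minus, OF \<open>0 < t\<close> \<open>0 < - d t\<close>]
  have "0 < - v 0 \<and> - a 0 < - A P"
    using inc by (elim exE conjE) (intro conjI, assumption+)
  then show ?thesis by simp
next
  case False
  then have zero: "d y = 0" if "0 < y" for y using assms that by force
  have m: "m y = P" if "0 < y" for y
    by (rule constant_if_d_zero(1)[of y y]) (use zero that in auto)
  have v0: "v y = 0" if "0 < y" for y using m[OF that] v_eq[OF that] by simp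
  have a0: "a y = A P" if "0 < y" for y using m[OF that] zero[OF that] by (simp add: d_def)
  have lim: "(f \<longlongrightarrow> f 0) (at_right 0)" if "continuous_on {0..} f" for f :: "real \<Rightarrow> real"
  proof -
    have "(f \<longlongrightarrow> f 0) (at 0 within {0..})" using that by (simp add: continuous_on_def)
    then show ?thesis by (simp only: at_within_Ici_at_right)
  qed
  have ev: "\<forall>\<^sub>F y::real in at_right 0. 0 < y" by (simp add: eventually_at_right_less)
  have "((\<lambda>_::real. 0) \<longlongrightarrow> v 0) (at_right 0)"
    by (rule Lim_transform_eventually[OF lim[OF v_cont]]) (use ev v0 in \<open>auto elim: eventually_mono\<close>)
  then have "v 0 = 0" by (simp add: tendsto_const_iff)
  moreover have "((\<lambda>_::real. A P) \<longlongrightarrow> a 0) (at_right 0)"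
    by (rule Lim_transform_eventually[OF lim[OF a_cont]]) (use ev a0 in \<open>auto elim: eventually_mono\<close>)
  then have "a 0 = A P" by (simp add: tendsto_const_iff)
  ultimately show ?thesis by simp
qed

lemma dichotomy:
  "v 0 \<le> 0 \<and> A P \<le> a 0 \<or>
   (\<exists>N'. negligible N' \<and> 0 < v 0 \<and> (\<forall>y\<ge>0. 0 \<le> v y) \<and>
      (\<forall>y>0. y \<notin> N' \<longrightarrow> u y \<le> P \<and> A (u y) = a y) \<and>
      (\<forall>x y. 0 < x \<longrightarrow> x < y \<longrightarrow> x \<notin> N' \<longrightarrow> y \<notin> N' \<longrightarrow> u x \<le> u y) \<and>
      (\<forall>t>0. a 0 < a t) \<and> a 0 < A P)"
proof (cases "\<exists>t>0. 0 < d t")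
  case True
  then show ?thesis using increasing_case by blast
next
  case False
  then have "d t \<le> 0" if "0 < t" for t using that by force
  then show ?thesis using nonincreasing_case by blast
qed

end

section \<open>Gaussian decay and flux bounds for monotone solutions\<close>

text \<open>
  The function \<open>p s * exp (\<kappa> * s\<^sup>2)\<close> is nonincreasing up to quadratically small errors, because
  \<open>1 + 2 \<kappa> s (t - s)\<close> and \<open>exp (\<kappa> * (t\<^sup>2 - s\<^sup>2))\<close> agree to first order in \<open>t - s\<close>.
\<close>

lemma gaussian_decay_if_infinitesimal_decay:
  fixes p :: "real \<Rightarrow> real"
  assumes \<kappa>: "0 \<le> \<kappa>" and zy: "0 \<le> z" "z \<le> y"
    and nonneg: "\<And>s. z \<le> s \<Longrightarrow> s \<le> y \<Longrightarrow> 0 \<le> p s"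
    and step: "\<And>s t. z \<le> s \<Longrightarrow> s \<le> t \<Longrightarrow> t \<le> y \<Longrightarrow> p t * (1 + 2 * \<kappa> * s * (t - s)) \<le> p s"
  shows "p y \<le> p z * exp (- \<kappa> * (y\<^sup>2 - z\<^sup>2))"
proof -
  define f where "f s = p s * exp (\<kappa> * s\<^sup>2)" for s
  define B where "B = p z * exp (\<kappa> * y\<^sup>2)"
  define C where "C = B * ((2 * \<kappa> * y)\<^sup>2 + \<kappa>)"
  have "f y \<le> f z"
  proof (rule nonincreasing_if_quadratically_small[OF zy(2), where g="\<lambda>s. C * s"])
    fix s t assume st: "z \<le> s" "s \<le> t" "t \<le> y"
    define X where "X = \<kappa> * (t\<^sup>2 - s\<^sup>2)"
    have X_eq: "X = (t - s) * (\<kappa> * (t + s))" by (simp add: X_def power2_eq_square algebra_simps)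
    have X0: "0 \<le> X" unfolding X_eq using st zy \<kappa> by simp
    have "X \<le> (t - s) * (2 * \<kappa> * y)"
      unfolding X_eq using st zy \<kappa> mult_left_mono[of "t + s" "2 * y" \<kappa>] by (intro mult_left_mono) auto
    then have "X\<^sup>2 \<le> ((t - s) * (2 * \<kappa> * y))\<^sup>2" using X0 by (intro power_mono)
    then have X2: "X\<^sup>2 \<le> (t - s)\<^sup>2 * (2 * \<kappa> * y)\<^sup>2" by (simp add: power_mult_distrib)
    have "p t * 1 \<le> p t * (1 + 2 * \<kappa> * z * (t - z))"
      using nonneg[of t] st zy \<kappa> by (intro mult_left_mono) auto
    also have "\<dots> \<le> p z" using step[of z t] st by simp
    finally have "f t \<le> B"
      unfolding f_def B_def using st zy \<kappa> nonneg[of z] nonneg[of t]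
      by (intro mult_mono) (auto intro!: mult_left_mono power_mono)
    have ft: "0 \<le> f t" unfolding f_def using nonneg[of t] st zy by simp
    have es: "exp (\<kappa> * s\<^sup>2) = exp (\<kappa> * t\<^sup>2) * exp (- X)"
      by (simp add: X_def algebra_simps flip: exp_add)
    have "(1 + X) * (1 - X) \<le> (1 + X) * exp (- X)"
      using X0 exp_ge_add_one_self[of "- X"] by (intro mult_left_mono) auto
    then have "1 - X\<^sup>2 \<le> (1 + X) * exp (- X)" by (simp add: power2_eq_square algebra_simps)
    moreover have "\<kappa> * (t - s)\<^sup>2 * exp (- X) \<le> \<kappa> * (t - s)\<^sup>2 * 1"
      using X0 \<kappa> by (intro mult_left_mono) auto
    moreover have "1 + 2 * \<kappa> * s * (t - s) = 1 + X - \<kappa> * (t - s)\<^sup>2"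
      by (simp add: X_def power2_eq_square algebra_simps)
    then have "(1 + 2 * \<kappa> * s * (t - s)) * exp (- X) = (1 + X) * exp (- X) - \<kappa> * (t - s)\<^sup>2 * exp (- X)"
      by (simp only: left_diff_distrib)
    ultimately have low: "1 - (1 + 2 * \<kappa> * s * (t - s)) * exp (- X) \<le> X\<^sup>2 + \<kappa> * (t - s)\<^sup>2"
      by linarith
    have "p t * (1 + 2 * \<kappa> * s * (t - s)) * exp (\<kappa> * s\<^sup>2) \<le> f s"
      unfolding f_def using step[OF st] by (intro mult_right_mono) auto
    then have "f t - f s \<le> f t * (1 - (1 + 2 * \<kappa> * s * (t - s)) * exp (- X))"
      unfolding es by (simp add: f_def algebra_simps)
    also have "\<dots> \<le> f t * (X\<^sup>2 + \<kappa> * (t - s)\<^sup>2)" by (rule mult_left_mono[OF low ft])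
    also have "\<dots> \<le> B * ((t - s)\<^sup>2 * (2 * \<kappa> * y)\<^sup>2 + \<kappa> * (t - s)\<^sup>2)"
      using \<open>f t \<le> B\<close> ft X2 \<kappa> by (intro mult_mono) auto
    also have "\<dots> = (t - s) * (C * t - C * s)"
      by (simp add: C_def power2_eq_square algebra_simps)
    finally show "f t - f s \<le> (t - s) * (C * t - C * s)" .
  qed
  then have "p y * exp (\<kappa> * y\<^sup>2) * exp (- (\<kappa> * y\<^sup>2)) \<le> p z * exp (\<kappa> * z\<^sup>2) * exp (- (\<kappa> * y\<^sup>2))"
    unfolding f_def by (intro mult_right_mono) auto
  then show ?thesis by (simp add: mult.assoc algebra_simps flip: exp_add)
qed

text \<open>
  The integrated equation for \<open>y \<ge> 0\<close> with a nondecreasing everywhere-defined solution, for which \<open>A \<circ> U\<close>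
  coincides with its continuous representative at every point, including jumps of \<open>U\<close>.
\<close>

locale monotone_half_line =
  fixes E A U v :: "real \<Rightarrow> real" and P M :: real
  assumes U_mono: "\<And>s t. 0 \<le> s \<Longrightarrow> s \<le> t \<Longrightarrow> U s \<le> U t"
    and U_le: "\<And>y. 0 \<le> y \<Longrightarrow> U y \<le> P"
    and U0: "U 0 < P"
    and E_cont: "continuous_on UNIV E" and E_nonneg: "\<And>s. 0 \<le> E s"
    and E_le: "\<And>s. U 0 \<le> s \<Longrightarrow> s \<le> P \<Longrightarrow> E s \<le> M" and M: "0 < M"
    and A_der: "\<And>s. (A has_real_derivative E s) (at s)"
    and v_int: "indefinite_integral_on {0..} (\<lambda>y. U y - P) v"
    and v_nonneg: "\<And>y. 0 \<le> y \<Longrightarrow> 0 \<le> v y"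
    and AU_int: "indefinite_integral_on {0..} (\<lambda>y. (v y - y * (U y - P)) / 2) (\<lambda>y. A (U y))"
begin

definition Q where "Q y = (v y - y * (U y - P)) / 2"

lemma Q_ge:
  assumes y: "0 \<le> y"
  shows "v y / 2 \<le> Q y" "y * (P - U y) / 2 \<le> Q y"
proof -
  have eq: "Q y = v y / 2 + y * (P - U y) / 2" by (simp add: Q_def field_simps)
  have "0 \<le> v y" "0 \<le> y * (P - U y)" using v_nonneg[OF y] U_le[OF y] y by auto
  then show "v y / 2 \<le> Q y" "y * (P - U y) / 2 \<le> Q y" unfolding eq by linarith+
qed

lemma Q_nonneg: "0 \<le> y \<Longrightarrow> 0 \<le> Q y"
  using Q_ge(1)[of y] v_nonneg[of y] by simp

lemma Q_0: "Q 0 = v 0 / 2" by (simp add: Q_def)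

lemma linear_int: "indefinite_integral_on {0..} (\<lambda>_. c) (\<lambda>y. c * y)"
  by (rule indefinite_integral_on_derivative) (auto intro!: derivative_eq_intros simp: is_interval_ci)

lemma E_int: "indefinite_integral_on UNIV E A"
  by (rule indefinite_integral_on_derivative) (use A_der E_cont in auto)

lemma v_step:
  assumes "0 \<le> s" "s \<le> t"
  shows "v t - v s \<le> (t - s) * (U t - P)" "(t - s) * (U s - P) \<le> v t - v s"
proof -
  have "v t - v s \<le> (U t - P) * t - (U t - P) * s"
    by (rule indefinite_integral_on_mono[OF v_int linear_int negligible_empty]) (use assms U_mono in auto)
  then show "v t - v s \<le> (t - s) * (U t - P)" by (simp add: algebra_simps)
  have "(U s - P) * t - (U s - P) * s \<le> v t - v s"
    by (rule indefinite_integral_on_mono[OF linear_int v_int negligible_empty]) (use assms U_mono in auto)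
  then show "(t - s) * (U s - P) \<le> v t - v s" by (simp add: algebra_simps)
qed

lemma Q_step:
  assumes "0 \<le> s" "s \<le> t"
  shows "s / 2 * (U t - U s) \<le> Q s - Q t"
  using v_step(1)[OF assms] by (simp add: Q_def field_simps)

lemma Q_antimono: "0 \<le> s \<Longrightarrow> s \<le> t \<Longrightarrow> Q t \<le> Q s"
  using Q_step[of s t] U_mono[of s t] mult_nonneg_nonneg[of "s/2" "U t - U s"] by linarith

lemma AU_step:
  assumes "0 \<le> s" "s \<le> t"
  shows "(t - s) * Q t \<le> A (U t) - A (U s)" "A (U t) - A (U s) \<le> (t - s) * Q s"
proof -
  have "Q t * t - Q t * s \<le> A (U t) - A (U s)"
    by (rule indefinite_integral_on_mono[OF linear_int AU_int negligible_empty])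
      (use assms Q_antimono in \<open>auto simp flip: Q_def\<close>)
  then show "(t - s) * Q t \<le> A (U t) - A (U s)" by (simp add: algebra_simps)
  have "A (U t) - A (U s) \<le> Q s * t - Q s * s"
    by (rule indefinite_integral_on_mono[OF AU_int linear_int negligible_empty])
      (use assms Q_antimono in \<open>auto simp flip: Q_def\<close>)
  then show "A (U t) - A (U s) \<le> (t - s) * Q s" by (simp add: algebra_simps)
qed

lemma A_step:
  assumes "0 \<le> s" "s \<le> t"
  shows "A (U t) - A (U s) \<le> M * (U t - U s)"
proof -
  have const: "indefinite_integral_on UNIV (\<lambda>_. M) (\<lambda>x. M * x)"
    by (rule indefinite_integral_on_derivative) (auto intro!: derivative_eq_intros)
  have "A (U t) - A (U s) \<le> M * U t - M * U s"
    by (rule indefinite_integral_on_mono[OF E_int const negligible_empty])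
      (use assms U_mono[of s t] U_mono[of 0 s] U_le[of t] in \<open>auto intro!: E_le\<close>)
  then show ?thesis by (simp add: algebra_simps)
qed

lemma U_step:
  assumes "0 \<le> s" "s \<le> t"
  shows "(t - s) * Q t / M \<le> U t - U s"
  using AU_step(1)[OF assms] A_step[OF assms] M by (simp add: field_simps)

lemma U_decay:
  assumes "0 \<le> z" "z \<le> y"
  shows "P - U y \<le> (P - U z) * exp (- (y\<^sup>2 - z\<^sup>2) / (4 * M))"
proof -
  have "P - U y \<le> (P - U z) * exp (- (1 / (4 * M)) * (y\<^sup>2 - z\<^sup>2))"
  proof (rule gaussian_decay_if_infinitesimal_decay[OF _ assms, where p="\<lambda>y. P - U y"])
    fix s t assume st: "z \<le> s" "s \<le> t" "t \<le> y"
    have "s * (P - U t) / 2 \<le> t * (P - U t) / 2"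
      using st assms U_le[of t] by (intro divide_right_mono mult_right_mono) auto
    also have "\<dots> \<le> Q t" using Q_ge(2)[of t] st assms by simp
    finally have "(t - s) * (s * (P - U t) / 2) / M \<le> (t - s) * Q t / M"
      using st M by (intro divide_right_mono mult_left_mono) auto
    also have "\<dots> \<le> U t - U s" using st assms by (intro U_step) auto
    finally show "(P - U t) * (1 + 2 * (1 / (4 * M)) * s * (t - s)) \<le> P - U s"
      using M by (simp add: field_simps)
  qed (use assms M U_le in auto)
  moreover have "- (1 / (4 * M)) * (y\<^sup>2 - z\<^sup>2) = - (y\<^sup>2 - z\<^sup>2) / (4 * M)"
    by (simp only: mult_minus_left times_divide_eq_left mult_1 minus_divide_left)
  ultimately show ?thesis by (simp only:)
qed

lemma Q_decay:
  assumes "0 \<le> z" "z \<le> y"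
  shows "Q y \<le> Q z * exp (- (y\<^sup>2 - z\<^sup>2) / (4 * M))"
proof -
  have "Q y \<le> Q z * exp (- (1 / (4 * M)) * (y\<^sup>2 - z\<^sup>2))"
  proof (rule gaussian_decay_if_infinitesimal_decay[OF _ assms])
    fix s t assume st: "z \<le> s" "s \<le> t" "t \<le> y"
    have "s / 2 * ((t - s) * Q t / M) \<le> s / 2 * (U t - U s)"
      using st assms by (intro mult_left_mono U_step) auto
    also have "\<dots> \<le> Q s - Q t" using st assms by (intro Q_step) auto
    finally show "Q t * (1 + 2 * (1 / (4 * M)) * s * (t - s)) \<le> Q s"
      using M by (simp add: field_simps)
  qed (use assms M Q_nonneg in auto)
  moreover have "- (1 / (4 * M)) * (y\<^sup>2 - z\<^sup>2) = - (y\<^sup>2 - z\<^sup>2) / (4 * M)"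
    by (simp only: mult_minus_left times_divide_eq_left mult_1 minus_divide_left)
  ultimately show ?thesis by (simp only:)
qed

lemma gaussian_le: "0 < y \<Longrightarrow> exp (- y\<^sup>2 / (4 * M)) \<le> 4 * M / y\<^sup>2"
proof -
  assume "0 < y"
  have "y\<^sup>2 / (4 * M) \<le> exp (y\<^sup>2 / (4 * M))" using exp_ge_add_one_self[of "y\<^sup>2 / (4 * M)"] by linarith
  then have "inverse (exp (y\<^sup>2 / (4 * M))) \<le> inverse (y\<^sup>2 / (4 * M))"
    using \<open>0 < y\<close> M by (intro le_imp_inverse_le) auto
  then show ?thesis by (simp add: exp_minus inverse_eq_divide)
qed

lemma U_tendsto: "(U \<longlongrightarrow> P) at_top"
proof (rule tendsto_sandwich[of "\<lambda>y. P - (P - U 0) * (4 * M) * (inverse y * inverse y)" _ _ "\<lambda>_. P"])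
  show "\<forall>\<^sub>F y in at_top. P - (P - U 0) * (4 * M) * (inverse y * inverse y) \<le> U y"
    using eventually_gt_at_top[of 0]
  proof eventually_elim
    case (elim y)
    have "P - U y \<le> (P - U 0) * exp (- y\<^sup>2 / (4 * M))" using U_decay[of 0 y] elim by simp
    also have "\<dots> \<le> (P - U 0) * (4 * M / y\<^sup>2)"
      using U0 elim by (intro mult_left_mono gaussian_le) auto
    finally show ?case by (simp add: field_simps power2_eq_square)
  qed
  show "\<forall>\<^sub>F y in at_top. U y \<le> P"
    using eventually_ge_at_top[of 0] by eventually_elim (rule U_le)
  have "((\<lambda>y. P - (P - U 0) * (4 * M) * (inverse y * inverse y)) \<longlongrightarrow> P - (P - U 0) * (4 * M) * (0 * 0)) at_top"
    by (intro tendsto_intros tendsto_inverse_0_at_top filterlim_ident)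
  then show "((\<lambda>y. P - (P - U 0) * (4 * M) * (inverse y * inverse y)) \<longlongrightarrow> P) at_top" by simp
qed simp

lemma y_v_tendsto: "((\<lambda>y. y * v y) \<longlongrightarrow> 0) at_top"
proof (rule tendsto_sandwich[of "\<lambda>_. 0" _ _ "\<lambda>y. 8 * M * Q 0 * inverse y"])
  show "\<forall>\<^sub>F y in at_top. y * v y \<le> 8 * M * Q 0 * inverse y"
    using eventually_gt_at_top[of 0]
  proof eventually_elim
    case (elim y)
    have "v y \<le> 2 * Q y" using Q_ge(1)[of y] elim by simp
    also have "\<dots> \<le> 2 * (Q 0 * exp (- y\<^sup>2 / (4 * M)))" using Q_decay[of 0 y] elim by simp
    also have "\<dots> \<le> 2 * (Q 0 * (4 * M / y\<^sup>2))"
      using Q_nonneg[of 0] elim by (intro mult_left_mono gaussian_le) auto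
    finally have "y * v y \<le> y * (2 * (Q 0 * (4 * M / y\<^sup>2)))" using elim by (intro mult_left_mono) auto
    then show ?case using elim by (simp add: field_simps power2_eq_square)
  qed
  show "\<forall>\<^sub>F y in at_top. 0 \<le> y * v y"
    using eventually_ge_at_top[of 0] by eventually_elim (simp add: v_nonneg)
  have "((\<lambda>y. 8 * M * Q 0 * inverse y) \<longlongrightarrow> 8 * M * Q 0 * 0) at_top"
    by (intro tendsto_intros tendsto_inverse_0_at_top filterlim_ident)
  then show "((\<lambda>y. 8 * M * Q 0 * inverse y) \<longlongrightarrow> 0) at_top" by simp
qed simp

text \<open>
  Change of variables \<open>E(U) dU = Q dy\<close>, written as an inequality between increments: over \<open>{s..t}\<close> the
  increment of \<open>B \<circ> U\<close> is at most \<open>(P - U s) * (t - s) * Q 0\<close>, and replacing \<open>P - U s\<close> by the mean of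
  \<open>P - U\<close> costs a quadratically small error weighted by the increasing function \<open>Q 0 * U\<close>.
\<close>

lemma weighted_integral_le:
  assumes B: "\<And>s. (B has_real_derivative (P - s) * E s) (at s)"
  shows "B P - B (U 0) \<le> 2 * (Q 0)\<^sup>2"
proof -
  have B_int: "indefinite_integral_on UNIV (\<lambda>s. (P - s) * E s) B"
    by (rule indefinite_integral_on_derivative) (use B E_cont in \<open>auto intro!: continuous_intros\<close>)
  have bound: "B (U y) \<le> B (U 0) + 2 * (Q 0)\<^sup>2" if "0 \<le> y" for y
  proof -
    have "B (U y) + Q 0 * v y \<le> B (U 0) + Q 0 * v 0"
    proof (rule nonincreasing_if_quadratically_small[OF that, where g="\<lambda>y. Q 0 * U y"])
      fix s t assume st: "0 \<le> s" "s \<le> t" "t \<le> y"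
      have "B (U t) - B (U s) \<le> (P - U s) * A (U t) - (P - U s) * A (U s)"
      proof (rule indefinite_integral_on_mono[OF B_int indefinite_integral_on_cmult[OF E_int] negligible_empty])
        show "(P - x) * E x \<le> (P - U s) * E x" if "U s \<le> x" for x
          using that E_nonneg by (intro mult_right_mono) auto
      qed (use st U_mono[of s t] in auto)
      also have "\<dots> = (P - U s) * (A (U t) - A (U s))" by (simp add: algebra_simps)
      also have "\<dots> \<le> (P - U s) * ((t - s) * Q 0)"
      proof (rule mult_left_mono)
        have "A (U t) - A (U s) \<le> (t - s) * Q s" using st by (intro AU_step) auto
        also have "\<dots> \<le> (t - s) * Q 0" using st Q_antimono[of 0 s] by (intro mult_left_mono) auto
        finally show "A (U t) - A (U s) \<le> (t - s) * Q 0" .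
      qed (use U_le[of s] st in auto)
      finally have 1: "B (U t) - B (U s) \<le> (P - U s) * ((t - s) * Q 0)" .
      have "Q 0 * (v t - v s) \<le> Q 0 * ((t - s) * (U t - P))"
        using Q_nonneg[of 0] st v_step(1)[of s t] by (intro mult_left_mono) auto
      with 1 show "B (U t) + Q 0 * v t - (B (U s) + Q 0 * v s) \<le> (t - s) * (Q 0 * U t - Q 0 * U s)"
        by (simp add: algebra_simps)
    qed
    moreover have "0 \<le> Q 0 * v y" using Q_nonneg[of 0] v_nonneg[OF that] by simp
    ultimately show ?thesis by (simp add: Q_0 power2_eq_square field_simps)
  qed
  have "isCont B P" using B DERIV_isCont by blast
  then have "((\<lambda>y. B (U y)) \<longlongrightarrow> B P) at_top" using isCont_tendsto_compose[OF _ U_tendsto] by blast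
  moreover have "\<forall>\<^sub>F y in at_top. B (U y) \<le> B (U 0) + 2 * (Q 0)\<^sup>2"
    using eventually_ge_at_top[of 0] by eventually_elim (rule bound)
  ultimately have "B P \<le> B (U 0) + 2 * (Q 0)\<^sup>2"
    by (intro tendsto_upperbound) auto
  then show ?thesis by simp
qed

text \<open>
  The function \<open>A \<circ> U + y * v / 2\<close> is a primitive of \<open>v\<close>, and \<open>y * v\<close> tends to zero; so the increment of \<open>A\<close> is
  the area under \<open>v\<close>, which contains the triangle under its lower bound \<open>v 0 - (P - U 0) * y\<close>.
\<close>

lemma two_Q_squared_le: "2 * (Q 0)\<^sup>2 \<le> (P - U 0) * (A P - A (U 0))"
proof -
  define p where "p = P - U 0"
  \<comment> \<open>the triangle under the line \<open>v 0 - p * y\<close> has its vertex at \<open>v 0 / p\<close>\<close>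
  define r where "r = v 0 / p"
  have p: "0 < p" using U0 by (simp add: p_def)
  have r: "0 \<le> r" using v_nonneg[of 0] p by (simp add: r_def)
  have "indefinite_integral_on {0..} (\<lambda>y. v y * 1 + (U y - P) * y) (\<lambda>y. v y * y)"
    by (rule indefinite_integral_on_mult[OF v_int]) (auto intro!: derivative_eq_intros)
  from indefinite_integral_on_add[OF AU_int indefinite_integral_on_cmult[OF this, of "1/2"]]
  have W: "indefinite_integral_on {0..} v (\<lambda>y. A (U y) + 1/2 * (v y * y))"
    by (rule indefinite_integral_on_cong[where N="{}"]) (auto simp: field_simps)
  have zero_int: "indefinite_integral_on {0..} (\<lambda>_. 0) (\<lambda>_. 0)" by (simp add: indefinite_integral_on_def)
  have quad: "indefinite_integral_on {0..} (\<lambda>y. v 0 - p * y) (\<lambda>y. v 0 * y - p * y\<^sup>2 / 2)"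
    by (rule indefinite_integral_on_derivative)
      (auto intro!: derivative_eq_intros continuous_intros simp: is_interval_ci)
  have "(v 0 * r - p * r\<^sup>2 / 2) - (v 0 * 0 - p * 0\<^sup>2 / 2)
      \<le> (A (U r) + 1/2 * (v r * r)) - (A (U 0) + 1/2 * (v 0 * 0))"
  proof (rule indefinite_integral_on_mono[OF quad W negligible_empty])
    fix y :: real assume "0 \<le> y"
    then show "v 0 - p * y \<le> v y" using v_step(2)[of 0 y] by (simp add: p_def algebra_simps)
  qed (use r in auto)
  moreover have "v 0 * r - p * r\<^sup>2 / 2 = 2 * (Q 0)\<^sup>2 / p"
    using p by (simp add: r_def Q_0 field_simps power2_eq_square)
  ultimately have at_r: "2 * (Q 0)\<^sup>2 / p \<le> A (U r) + 1/2 * (v r * r) - A (U 0)" by simp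
  have bound: "2 * (Q 0)\<^sup>2 / p \<le> A (U y) + 1/2 * (y * v y) - A (U 0)" if "r \<le> y" for y
  proof -
    have "0 - 0 \<le> (A (U y) + 1/2 * (v y * y)) - (A (U r) + 1/2 * (v r * r))"
      by (rule indefinite_integral_on_mono[OF zero_int W negligible_empty])
        (use r that v_nonneg in auto)
    then show ?thesis using at_r by (simp add: mult.commute)
  qed
  have "isCont A P" using A_der DERIV_isCont by blast
  then have "((\<lambda>y. A (U y)) \<longlongrightarrow> A P) at_top" using isCont_tendsto_compose[OF _ U_tendsto] by blast
  then have "((\<lambda>y. A (U y) + 1/2 * (y * v y) - A (U 0)) \<longlongrightarrow> A P + 1/2 * 0 - A (U 0)) at_top"
    by (intro tendsto_intros y_v_tendsto)
  moreover have "\<forall>\<^sub>F y in at_top. 2 * (Q 0)\<^sup>2 / p \<le> A (U y) + 1/2 * (y * v y) - A (U 0)"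
    using eventually_ge_at_top[of r] by eventually_elim (rule bound)
  ultimately have "2 * (Q 0)\<^sup>2 / p \<le> A P + 1/2 * 0 - A (U 0)"
    by (intro tendsto_lowerbound) auto
  then show ?thesis using p by (simp add: p_def field_simps)
qed

end

section \<open>Monotone representatives\<close>

lemma negligible_uminus:
  fixes N :: "real set"
  assumes "negligible N"
  shows "negligible {x. - x \<in> N}"
proof -
  have "negligible (uminus ` N)"
    by (rule negligible_differentiable_image_negligible[OF order_refl assms])
      (auto simp: differentiable_on_def)
  moreover have "uminus ` N = {x. - x \<in> N}" by force
  ultimately show ?thesis by simp
qed

lemma exists_in_interval_off_negligible:
  fixes a b :: real
  assumes "negligible N" "a < b"
  obtains x where "a < x" "x < b" "x \<notin> N"
proof -
  have "\<not> negligible {a<..<b}" using negligible_interval(2)[of a b] assms(2) by simp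
  then have "\<not> {a<..<b} \<subseteq> N" using negligible_subset[OF assms(1)] by blast
  then obtain x where "x \<in> {a<..<b}" "x \<notin> N" by blast
  then show thesis using that[of x] by simp
qed

text \<open>
  The value at \<open>y\<close> is the supremum of \<open>u\<close> over the points up to \<open>y\<close> outside the null set, of which there are
  always some because a null set contains no interval.
\<close>

lemma mono_representative:
  fixes u :: "real \<Rightarrow> real"
  assumes N: "negligible N"
    and mono: "\<And>x y. x < y \<Longrightarrow> x \<notin> N \<Longrightarrow> y \<notin> N \<Longrightarrow> u x \<le> u y"
    and bounds: "\<And>x. x \<notin> N \<Longrightarrow> c \<le> u x \<and> u x \<le> d"
  shows "\<exists>U. mono U \<and> (\<forall>x. x \<notin> N \<longrightarrow> U x = u x) \<and> (\<forall>x. c \<le> U x \<and> U x \<le> d)"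
proof -
  define S where "S y = {u x | x. x \<le> y \<and> x \<notin> N}" for y
  define U where "U y = Sup (S y)" for y
  have ne: "S y \<noteq> {}" for y
    using exists_in_interval_off_negligible[OF N, of "y - 1" y] unfolding S_def by force
  have bdd: "bdd_above (S y)" for y using bounds by (auto simp: S_def bdd_above_def)
  have "mono U"
  proof (rule monoI)
    fix x y :: real assume "x \<le> y"
    then have "S x \<subseteq> S y" by (force simp: S_def)
    then show "U x \<le> U y" unfolding U_def by (intro cSup_subset_mono ne bdd)
  qed
  moreover have "U x = u x" if "x \<notin> N" for x
    unfolding U_def
  proof (rule cSup_eq_maximum)
    show "u x \<in> S x" using that by (auto simp: S_def)
    show "r \<le> u x" if "r \<in> S x" for r
      using that mono[of _ x] \<open>x \<notin> N\<close> by (auto simp: S_def le_less)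
  qed
  moreover have "c \<le> U x \<and> U x \<le> d" for x
  proof
    obtain r where r: "r \<in> S x" using ne by blast
    then have "c \<le> r" using bounds by (auto simp: S_def)
    also have "r \<le> U x" unfolding U_def by (rule cSup_upper[OF r bdd])
    finally show "c \<le> U x" .
    show "U x \<le> d" unfolding U_def by (rule cSup_least[OF ne]) (use bounds in \<open>auto simp: S_def\<close>)
  qed
  ultimately show ?thesis by blast
qed

text \<open>
  A monotone function lies between its one-sided limits, both of which are values of \<open>g\<close> here.
\<close>

lemma mono_eq_continuous_if_AE_eq:
  fixes f g :: "real \<Rightarrow> real"
  assumes "mono f" "continuous_on UNIV g" and N: "negligible N"
    and eq: "\<And>x. x \<notin> N \<Longrightarrow> f x = g x"
  shows "f x = g x"
proof -
  have lim: "(g \<longlongrightarrow> g x) (at x)"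
    using assms(2) by (simp add: continuous_on_def)
  show ?thesis
  proof (rule antisym)
    show "f x \<le> g x"
    proof (rule ccontr)
      assume "\<not> f x \<le> g x"
      then have "\<forall>\<^sub>F y in at_right x. g y < f x"
        using order_tendstoD(2)[OF tendsto_within_subset[OF lim]] by force
      then obtain b where b: "x < b" "\<And>y. x < y \<Longrightarrow> y < b \<Longrightarrow> g y < f x"
        unfolding eventually_at_right_field by blast
      obtain y where "x < y" "y < b" "y \<notin> N" using exists_in_interval_off_negligible[OF N b(1)] .
      then show False using b(2)[of y] eq[of y] monoD[OF assms(1), of x y] by simp
    qed
    show "g x \<le> f x"
    proof (rule ccontr)
      assume "\<not> g x \<le> f x"
      then have "\<forall>\<^sub>F y in at_left x. f x < g y"
        using order_tendstoD(1)[OF tendsto_within_subset[OF lim]] by force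
      then obtain b where b: "b < x" "\<And>y. b < y \<Longrightarrow> y < x \<Longrightarrow> f x < g y"
        unfolding eventually_at_left_field by blast
      obtain y where "b < y" "y < x" "y \<notin> N" using exists_in_interval_off_negligible[OF N b(1)] .
      then show False using b(2)[of y] eq[of y] monoD[OF assms(1), of y x] by simp
    qed
  qed
qed

section \<open>The profile\<close>

theorem proposition3p3:
  fixes D u :: "real \<Rightarrow> real" and Um Up Dmin Dmax :: real
  assumes "Um < Up"
    and "continuous_on {Um..Up} D"
    and "Dmin = (INF s\<in>{Um..Up}. D s)" and "0 \<le> Dmin"
    and "Dmax = (SUP s\<in>{Um..Up}. D s)" and "0 < Dmax"
    and "is_profile D Um Up u"
  shows "\<exists>U Q. profile_flux_representatives D Um u U Q \<and>
    (\<forall>y z. 0 \<le> z \<and> z \<le> y \<longrightarrow>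
       0 \<le> Up - U y \<and> Up - U y \<le> (Up - U z) * exp (- (y\<^sup>2 - z\<^sup>2) / (4 * Dmax))) \<and>
    (\<forall>y z. 0 \<ge> z \<and> z \<ge> y \<longrightarrow>
       0 \<le> U y - Um \<and> U y - Um \<le> (U z - Um) * exp (- (y\<^sup>2 - z\<^sup>2) / (4 * Dmax))) \<and>
    (\<forall>y z. 0 \<le> z \<and> z \<le> y \<longrightarrow>
       0 \<le> Q y \<and> Q y \<le> Q z * exp (- (y\<^sup>2 - z\<^sup>2) / (4 * Dmax)) \<and>
       0 \<le> Q (- y) \<and> Q (- y) \<le> Q (- z) * exp (- (y\<^sup>2 - z\<^sup>2) / (4 * Dmax))) \<and>
    Um < U 0 \<and> U 0 < Up \<and> 0 < Q 0 \<and>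
    (LBINT s=Um..U 0. (s - Um) * D s) \<le> 2 * (Q 0)\<^sup>2 \<and>
    2 * (Q 0)\<^sup>2 \<le> (U 0 - Um) * (LBINT s=Um..U 0. D s) \<and>
    (LBINT s=U 0..Up. (Up - s) * D s) \<le> 2 * (Q 0)\<^sup>2 \<and>
    2 * (Q 0)\<^sup>2 \<le> (Up - U 0) * (LBINT s=U 0..Up. D s)"
proof -
  let ?st = "step_data Um Up"
  obtain v w E where u_meas: "u \<in> borel_measurable lebesgue"
    and vw: "H1_derivative v w" and u_eq: "AE y in lebesgue. u y = ?st y + w y"
    and E_cont: "continuous_on UNIV E" and E_bdd: "bounded (range E)" and E_nonneg: "\<And>s. 0 \<le> E s"
    and E_D: "\<And>s. s \<in> {Um..Up} \<Longrightarrow> E s = D s"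
    and weak: "\<And>\<psi>. Ck_c 2 \<psi> \<Longrightarrow> (LINT y|lebesgue. primitive_from Um E (u y) * (deriv ^^ 2) \<psi> y
              - u y * deriv (\<lambda>t. t / 2 * \<psi> t) y) = 0"
    using assms(7) unfolding is_profile_def L2_loc_def admissible_extension_def by blast
  define A where "A = primitive_from Um E"
  have A_der: "(A has_real_derivative E s) (at s)" for s
    unfolding A_def by (rule primitive_from_derivative[OF E_cont])
  have A_cont: "continuous_on UNIV A"
    using A_der DERIV_isCont by (intro continuous_at_imp_continuous_on) blast
  have A_int: "indefinite_integral_on UNIV E A"
    by (rule indefinite_integral_on_derivative) (use A_der E_cont in auto)
  have A_mono: "mono A"
  proof (rule monoI)
    fix x y :: real assume "x \<le> y"
    then show "A x \<le> A y"
      by (rule DERIV_nonneg_imp_nondecreasing) (rule exI, rule conjI, rule A_der, rule E_nonneg)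
  qed
  have D_bdd: "bdd_above (D ` {Um..Up})"
    by (rule bounded_imp_bdd_above[OF compact_imp_bounded[OF compact_continuous_image[OF assms(2) compact_Icc]]])
  have E_le: "E s \<le> Dmax" if "Um \<le> s" "s \<le> Up" for s
    using cSUP_upper[OF _ D_bdd, of s] that E_D[of s] by (simp add: assms(5))
  \<comment> \<open>the supremum of \<open>D\<close> is positive, so \<open>A\<close> separates the two end states\<close>
  have A_less: "A Um < A Up"
  proof -
    have "{Um..Up} \<noteq> {}" using assms(1) by simp
    then obtain s where s: "s \<in> {Um..Up}" "0 < D s"
      using less_cSUP_iff[OF _ D_bdd, of 0] assms(5,6) by auto
    have "integral {Um..Up} E \<noteq> 0"
      using integral_eq_0_iff[of Um Up E] continuous_on_subset[OF E_cont] assms(1) E_nonneg s E_D[OF s(1)] by force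
    moreover have "integral {Um..Up} E = A Up - A Um"
      using indefinite_integral_onD(4)[OF A_int, of Um Up] assms(1) by simp
    ultimately show ?thesis using monoD[OF A_mono, of Um Up] assms(1) by simp
  qed

  obtain V a N where N: "negligible N" and A_u: "\<And>y. y \<notin> N \<Longrightarrow> A (u y) = a y"
    and V_int: "indefinite_integral_on UNIV (\<lambda>y. u y - ?st y) V"
    and a_int: "indefinite_integral_on UNIV (\<lambda>y. (V y - y * (u y - ?st y)) / 2) a"
    and small: "\<And>e. 0 < e \<Longrightarrow> \<exists>L>0. \<forall>T. \<exists>t\<in>{T..T+L}. \<bar>V t\<bar> < e \<and> \<bar>a t - A (?st t)\<bar> < e"
    using weak_profile_equation[OF E_cont E_bdd u_meas vw u_eq weak] unfolding A_def by blast
  have V_cont: "continuous_on UNIV V" and a_cont: "continuous_on UNIV a"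
    using V_int a_int by (auto intro: indefinite_integral_on_UNIV_continuous)
  have small_right: "\<exists>t>T. \<bar>V t\<bar> < e \<and> \<bar>a t - A Up\<bar> < e" if e: "0 < e" for e T
  proof -
    obtain t where t: "t \<ge> max T 0 + 1" "\<bar>V t\<bar> < e" "\<bar>a t - A (?st t)\<bar> < e"
      using small[OF e] by (metis atLeastAtMost_iff)
    then have "0 \<le> t" by linarith
    then have "?st t = Up" by (simp add: step_data_def)
    then show ?thesis using t by (intro exI[of _ t]) auto
  qed
  have small_left: "\<exists>t>T. \<bar>V (- t)\<bar> < e \<and> \<bar>a (- t) - A Um\<bar> < e" if e: "0 < e" for e T
  proof -
    obtain L where L: "\<And>T. \<exists>t\<in>{T..T+L}. \<bar>V t\<bar> < e \<and> \<bar>a t - A (?st t)\<bar> < e"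
      using small[OF e] by blast
    obtain t where t: "t \<in> {- (max T 0 + 1 + L)..- (max T 0 + 1 + L) + L}"
      "\<bar>V t\<bar> < e" "\<bar>a t - A (?st t)\<bar> < e" using L by blast
    have "0 \<le> max T 0" "T \<le> max T 0" "t \<le> - max T 0 - 1" using t(1) by auto
    then have "t < 0" "T < - t" by linarith+
    then have "?st t = Um" by (simp add: step_data_def)
    then show ?thesis using t \<open>T < - t\<close> by (intro exI[of _ "- t"]) auto
  qed

  \<comment> \<open>the reflection \<open>y \<mapsto> - u (- y)\<close> exchanges the half lines\<close>
  have V_left: "indefinite_integral_on {0..} (\<lambda>y. - u (- y) - - Um) (\<lambda>y. V (- y))"
    by (rule indefinite_integral_on_cong[OF indefinite_integral_on_cmult[OF
            indefinite_integral_on_reflect[OF V_int], of "{0..}" "-1"], where N="{0}"])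
      (auto simp: step_data_def)
  have a_left: "indefinite_integral_on {0..} (\<lambda>y. (V (- y) - y * (- u (- y) - - Um)) / 2) (\<lambda>y. - a (- y))"
    by (rule indefinite_integral_on_cong[OF indefinite_integral_on_reflect[OF a_int, of "{0..}"], where N="{0}"])
      (auto simp: step_data_def algebra_simps)
  have V_right: "indefinite_integral_on {0..} (\<lambda>y. u y - Up) V"
    by (rule indefinite_integral_on_cong[OF indefinite_integral_on_subset[OF V_int], where N="{}"])
      (auto simp: step_data_def)
  have a_right: "indefinite_integral_on {0..} (\<lambda>y. (V y - y * (u y - Up)) / 2) a"
    by (rule indefinite_integral_on_cong[OF indefinite_integral_on_subset[OF a_int], where N="{}"])
      (auto simp: step_data_def)
  interpret right: weak_half_line A u a V Up N
  proof
    show "\<exists>t>T. \<bar>V t\<bar> < e" "\<exists>t>T. \<bar>a t - A Up\<bar> < e" if "0 < e" for T e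
      using small_right[OF that, of T] by blast+
  qed (rule A_mono A_cont N A_u V_right a_right, assumption?)+
  interpret left: weak_half_line "\<lambda>s. - A (- s)" "\<lambda>y. - u (- y)" "\<lambda>y. - a (- y)" "\<lambda>y. V (- y)" "- Um" "{x. - x \<in> N}"
  proof
    show "mono (\<lambda>s. - A (- s))" using A_mono by (auto simp: mono_def)
    show "continuous_on UNIV (\<lambda>s. - A (- s))"
      by (intro continuous_intros continuous_on_compose2[OF A_cont]) auto
    show "- A (- (- u (- y))) = - a (- y)" if "y \<notin> {x. - x \<in> N}" for y using A_u[of "- y"] that by simp
    show "\<exists>t>T. \<bar>V (- t)\<bar> < e" if "0 < e" for T e using small_left[OF that, of T] by blast
    show "\<exists>t>T. \<bar>- a (- t) - - A (- (- Um))\<bar> < e" if "0 < e" for T e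
      using small_left[OF that, of T] by (auto simp: abs_minus_commute)
  qed (rule negligible_uminus N V_left a_left)+

  \<comment> \<open>a solution that does not rise would have \<open>A Up \<le> a 0 \<le> A Um\<close>\<close>
  have "0 < V 0"
    using right.dichotomy left.dichotomy A_less by fastforce
  obtain N1 where N1: "negligible N1" and V_right_nonneg: "\<And>y. 0 \<le> y \<Longrightarrow> 0 \<le> V y"
    and u_right: "\<And>y. 0 < y \<Longrightarrow> y \<notin> N1 \<Longrightarrow> u y \<le> Up \<and> A (u y) = a y"
    and mono_right: "\<And>x y. 0 < x \<Longrightarrow> x < y \<Longrightarrow> x \<notin> N1 \<Longrightarrow> y \<notin> N1 \<Longrightarrow> u x \<le> u y"
    and a0_right: "\<And>t. 0 < t \<Longrightarrow> a 0 < a t" and a0_Up: "a 0 < A Up"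
    using right.dichotomy \<open>0 < V 0\<close> by (metis not_less)
  have "\<exists>N2. negligible N2 \<and> (\<forall>y\<ge>0. 0 \<le> V (- y)) \<and>
      (\<forall>y>0. y \<notin> N2 \<longrightarrow> Um \<le> u (- y) \<and> A (u (- y)) = a (- y)) \<and>
      (\<forall>x y. 0 < x \<longrightarrow> x < y \<longrightarrow> x \<notin> N2 \<longrightarrow> y \<notin> N2 \<longrightarrow> u (- y) \<le> u (- x)) \<and>
      (\<forall>t>0. a (- t) < a 0) \<and> A Um < a 0"
    using left.dichotomy \<open>0 < V 0\<close> by (simp add: not_le)
  then obtain N2 where N2: "negligible N2" and V_left_nonneg: "\<And>y. 0 \<le> y \<Longrightarrow> 0 \<le> V (- y)"
    and u_left: "\<And>y. 0 < y \<Longrightarrow> y \<notin> N2 \<Longrightarrow> Um \<le> u (- y) \<and> A (u (- y)) = a (- y)"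
    and mono_left: "\<And>x y. 0 < x \<Longrightarrow> x < y \<Longrightarrow> x \<notin> N2 \<Longrightarrow> y \<notin> N2 \<Longrightarrow> u (- y) \<le> u (- x)"
    and a0_left: "\<And>t. 0 < t \<Longrightarrow> a (- t) < a 0" and a0_Um: "A Um < a 0"
    by blast
  \<comment> \<open>the origin is excluded since the two half-line statements only concern nonzero points\<close>
  define M where "M = N1 \<union> {x. - x \<in> N2} \<union> {0}"
  have M: "negligible M" using N1 negligible_uminus[OF N2] by (simp add: M_def)
  have A_u': "A (u y) = a y" if "y \<notin> M" for y
    using u_right[of y] u_left[of "- y"] that by (cases "0 < y") (auto simp: M_def)
  have u_mono: "u x \<le> u y" if xy: "x < y" "x \<notin> M" "y \<notin> M" for x y
  proof -
    have "x \<noteq> 0" "y \<noteq> 0" using xy by (auto simp: M_def)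
    then consider "0 < x" | "y < 0" | "x < 0" "0 < y" using xy(1) by linarith
    then show ?thesis
    proof cases
      case 3
      then have "A (u x) < A (u y)"
        using a0_left[of "- x"] a0_right[of y] A_u'[OF xy(2)] A_u'[OF xy(3)] by simp
      then show ?thesis using monoD[OF A_mono, of "u y" "u x"] by linarith
    qed (use xy mono_right[of x y] mono_left[of "- y" "- x"] in \<open>auto simp: M_def\<close>)
  qed
  have u_bounds: "Um \<le> u y \<and> u y \<le> Up" if y: "y \<notin> M" for y
  proof -
    have "min y 0 - 1 < min y 0" "max y 0 < max y 0 + 1" by linarith+
    then obtain x z where x: "min y 0 - 1 < x" "x < min y 0" "x \<notin> M"
      and z: "max y 0 < z" "z < max y 0 + 1" "z \<notin> M"
      using exists_in_interval_off_negligible[OF M] by metis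
    have "Um \<le> u x" "u z \<le> Up" using u_left[of "- x"] u_right[of z] x z by (auto simp: M_def)
    then show ?thesis using u_mono[of x y] u_mono[of y z] x z y by force
  qed
  have "\<exists>U. mono U \<and> (\<forall>x. x \<notin> M \<longrightarrow> U x = u x) \<and> (\<forall>x. Um \<le> U x \<and> U x \<le> Up)"
    by (rule mono_representative[OF M]) (fact u_mono, fact u_bounds)
  then obtain U where U_mono: "mono U" and U_u: "\<And>x. x \<notin> M \<Longrightarrow> U x = u x"
    and U_bounds: "\<And>x. Um \<le> U x \<and> U x \<le> Up" by blast
  have AU: "A (U y) = a y" for y
  proof (rule mono_eq_continuous_if_AE_eq[OF _ a_cont M])
    show "mono (\<lambda>y. A (U y))" using A_mono U_mono by (auto simp: mono_def)
  qed (use U_u A_u' in auto)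
  have U0: "Um < U 0" "U 0 < Up"
    using a0_Um a0_Up AU[of 0] U_bounds[of 0] by (auto simp: less_le)

  define Q where "Q y = (V y - y * (U y - ?st y)) / 2" for y
  have Q_int: "indefinite_integral_on UNIV Q a"
    by (rule indefinite_integral_on_cong[OF a_int _ M]) (use U_u in \<open>auto simp: Q_def\<close>)
  interpret r: monotone_half_line E A U V Up Dmax
  proof
    show "indefinite_integral_on {0..} (\<lambda>y. U y - Up) V"
      by (rule indefinite_integral_on_cong[OF V_right _ M]) (use U_u in auto)
    show "indefinite_integral_on {0..} (\<lambda>y. (V y - y * (U y - Up)) / 2) (\<lambda>y. A (U y))"
      by (rule indefinite_integral_on_cong[OF a_right _ M]) (use U_u AU in auto)
  qed (use U_mono U_bounds U0 E_cont E_nonneg E_le assms(6) A_der V_right_nonneg in \<open>auto simp: mono_def\<close>)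
  interpret l: monotone_half_line "\<lambda>s. E (- s)" "\<lambda>s. - A (- s)" "\<lambda>y. - U (- y)" "\<lambda>y. V (- y)" "- Um" Dmax
  proof
    show "indefinite_integral_on {0..} (\<lambda>y. - U (- y) - - Um) (\<lambda>y. V (- y))"
      by (rule indefinite_integral_on_cong[OF V_left _ negligible_uminus[OF M]]) (use U_u in auto)
    show "indefinite_integral_on {0..} (\<lambda>y. (V (- y) - y * (- U (- y) - - Um)) / 2)
        (\<lambda>y. - A (- (- U (- y))))"
      by (rule indefinite_integral_on_cong[OF a_left _ negligible_uminus[OF M]]) (use U_u AU in auto)
    show "continuous_on UNIV (\<lambda>s. E (- s))" by (intro continuous_on_compose2[OF E_cont] continuous_intros) auto
    show "((\<lambda>s. - A (- s)) has_real_derivative E (- s)) (at s)" for s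
      using A_der[of "- s"] by (auto intro!: derivative_eq_intros DERIV_chain2[of A])
    show "E (- s) \<le> Dmax" if "- U (- 0) \<le> s" "s \<le> - Um" for s
      using E_le[of "- s"] U_bounds[of 0] that by simp
  qed (use U_mono U_bounds U0 E_nonneg assms(6) V_left_nonneg in \<open>auto simp: mono_def\<close>)
  have Q_right: "Q y = r.Q y" if "0 \<le> y" for y using that by (simp add: Q_def r.Q_def step_data_def)
  have Q_left: "Q (- y) = l.Q y" if "0 \<le> y" for y
    using that by (cases "y = 0") (auto simp: Q_def l.Q_def step_data_def algebra_simps)

  have flux: "profile_flux_representatives D Um u U Q"
    unfolding profile_flux_representatives_def
  proof (intro conjI allI impI)
    show "AE y in lebesgue. U y = u y"
      unfolding eventually_ae_filter_negligible using M U_u by blast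
    show "mono U" by (rule U_mono)
    have "primitive_from Um D (U y) = a y" for y
    proof -
      have "primitive_from Um D (U y) = primitive_from Um E (U y)"
        unfolding primitive_from_def
        by (rule interval_integral_cong) (use U_bounds[of y] E_D in \<open>auto simp: einterval_iff min_def\<close>)
      then show ?thesis using AU[of y] by (simp add: A_def)
    qed
    then show "has_weak_derivative (\<lambda>y. primitive_from Um D (U y)) Q"
      using has_weak_derivative_indefinite_integral[OF Q_int] by simp
    \<comment> \<open>a continuous function, although the step and, possibly, \<open>U\<close> and \<open>Q\<close> jump\<close>
    have eq: "Q y + y / 2 * U y = (V y + (Um * min 0 y + Up * max 0 y)) / 2" for y
      by (auto simp: Q_def step_data_def field_simps)
    show cont: "continuous_on UNIV (\<lambda>y. Q y + y / 2 * U y)"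
      unfolding eq by (intro continuous_intros V_cont) auto
    fix y assume "U differentiable at y"
    then have U': "(U has_real_derivative deriv U y) (at y)"
      by (simp add: DERIV_deriv_iff_real_differentiable)
    have "isCont (\<lambda>y. Q y + y / 2 * U y) y" using cont by (simp add: continuous_on_eq_continuous_at)
    moreover have "isCont (\<lambda>y. y / 2 * U y) y"
      by (intro continuous_intros DERIV_isCont[OF U']) simp
    ultimately have "isCont (\<lambda>y. (Q y + y / 2 * U y) - y / 2 * U y) y" by (rule continuous_diff)
    then have "isCont Q y" by simp
    then have "(a has_real_derivative Q y) (at y)" by (rule indefinite_integral_on_derivative_at[OF Q_int])
    moreover have "((\<lambda>y. A (U y)) has_real_derivative E (U y) * deriv U y) (at y)"
      by (rule DERIV_chain2[OF A_der U'])
    ultimately have "Q y = E (U y) * deriv U y" unfolding AU by (rule DERIV_unique)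
    then show "Q y = D (U y) * deriv U y" using E_D[of "U y"] U_bounds[of y] by simp
  qed

  have LBINT_D: "(LBINT s=ereal x..ereal y. f s * D s) = (LBINT s=ereal x..ereal y. f s * E s)"
    if "Um \<le> x" "x \<le> y" "y \<le> Up" for f x y
    by (rule interval_integral_cong) (use that E_D in \<open>auto simp: einterval_iff min_def\<close>)
  have LBINT_1: "(LBINT s=ereal x..ereal y. D s) = A y - A x"
    if "Um \<le> x" "x \<le> y" "y \<le> Up" for x y
    using LBINT_D[OF that, of "\<lambda>_. 1"] LBINT_antiderivative[OF A_der E_cont, of x y] by simp

  have "(LBINT s=U 0..Up. (Up - s) * D s) \<le> 2 * (Q 0)\<^sup>2"
  proof -
    have cont: "continuous_on UNIV (\<lambda>s. (Up - s) * E s)" using E_cont by (intro continuous_intros)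
    obtain B where B: "indefinite_integral_on UNIV (\<lambda>s. (Up - s) * E s) B"
      using L1_loc_indefinite_integral[OF L1_loc_continuous[OF cont]] by blast
    have B_der: "(B has_real_derivative (Up - s) * E s) (at s)" for s
      using cont by (intro indefinite_integral_on_derivative_at[OF B]) (simp add: continuous_on_eq_continuous_at)
    show ?thesis
      using r.weighted_integral_le[OF B_der] LBINT_antiderivative[OF B_der cont, of "U 0" Up]
        LBINT_D[of "U 0" Up "\<lambda>s. Up - s"] U0 Q_right[of 0] by simp
  qed
  moreover have "(LBINT s=Um..U 0. (s - Um) * D s) \<le> 2 * (Q 0)\<^sup>2"
  proof -
    have cont: "continuous_on UNIV (\<lambda>s. (s - Um) * E s)" using E_cont by (intro continuous_intros)
    obtain B where B: "indefinite_integral_on UNIV (\<lambda>s. (s - Um) * E s) B"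
      using L1_loc_indefinite_integral[OF L1_loc_continuous[OF cont]] by blast
    have B_der: "(B has_real_derivative (s - Um) * E s) (at s)" for s
      using cont by (intro indefinite_integral_on_derivative_at[OF B]) (simp add: continuous_on_eq_continuous_at)
    have "((\<lambda>s. - B (- s)) has_real_derivative (- Um - s) * E (- s)) (at s)" for s
      using B_der[of "- s"] by (auto intro!: derivative_eq_intros DERIV_chain2[of B] simp: algebra_simps)
    from l.weighted_integral_le[OF this] show ?thesis
      using LBINT_antiderivative[OF B_der cont, of Um "U 0"]
        LBINT_D[of Um "U 0" "\<lambda>s. s - Um"] U0 Q_left[of 0] by simp
  qed
  moreover have "2 * (Q 0)\<^sup>2 \<le> (Up - U 0) * (LBINT s=U 0..Up. D s)"
    using r.two_Q_squared_le LBINT_1[of "U 0" Up] U0 Q_right[of 0] by simp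
  moreover have "2 * (Q 0)\<^sup>2 \<le> (U 0 - Um) * (LBINT s=Um..U 0. D s)"
  proof -
    have "2 * (Q 0)\<^sup>2 \<le> (U 0 - Um) * (A (U 0) - A Um)"
      using l.two_Q_squared_le Q_left[of 0] by (simp add: algebra_simps)
    then show ?thesis using LBINT_1[of Um "U 0"] U0 by simp
  qed
  moreover have "0 < Q 0" using \<open>0 < V 0\<close> by (simp add: Q_def)
  moreover have "0 \<le> Up - U y \<and> Up - U y \<le> (Up - U z) * exp (- (y\<^sup>2 - z\<^sup>2) / (4 * Dmax))"
    if "0 \<le> z \<and> z \<le> y" for y z using r.U_decay[of z y] U_bounds[of y] that by simp
  moreover have "0 \<le> U y - Um \<and> U y - Um \<le> (U z - Um) * exp (- (y\<^sup>2 - z\<^sup>2) / (4 * Dmax))"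
    if "0 \<ge> z \<and> z \<ge> y" for y z using l.U_decay[of "- z" "- y"] U_bounds[of y] that by simp
  moreover have "0 \<le> Q y \<and> Q y \<le> Q z * exp (- (y\<^sup>2 - z\<^sup>2) / (4 * Dmax)) \<and>
       0 \<le> Q (- y) \<and> Q (- y) \<le> Q (- z) * exp (- (y\<^sup>2 - z\<^sup>2) / (4 * Dmax))"
    if "0 \<le> z \<and> z \<le> y" for y z
    using r.Q_decay[of z y] l.Q_decay[of z y] r.Q_nonneg[of y] l.Q_nonneg[of y] that
    by (simp add: Q_right Q_left)
  ultimately show ?thesis
    using flux U0 by (intro exI[of _ U] exI[of _ Q] conjI allI impI) simp_all
qed

end
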